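(* Let $N\ge2$ and $k\ge1$ be integers. Define $$F_N(z)=\sum_{m=0}^{\infty}\frac{(Nm)!^k}{m!^{kN}}z^m,\qquad G_N(z)=k\sum_{m=1}^{\infty}\frac{(Nm)!^k}{m!^{kN}}\Big(\sum_{j=1}^{N-1}H(j/N,m)-(N-1)H(1,m)\Big)z^m,$$ with $H(x,m)=\sum_{n=0}^{m-1}\frac{1}{x+n}$, and $q_N(z)=z\exp(G_N(z)/F_N(z))$. Let $$\Omega_N=\prod_{p\le N,\ p\text{ prime}}p^{\min\{2+\omega(p,N),\,v_p(H_N-1)\}},$$ where $\omega(p,N)=1$ if $p$ is a Wolstenholme prime or $N\equiv\pm1\pmod p$, and $\omega(p,N)=0$ otherwise. Then $$\big(z^{-1}q_N(z)\big)^{\frac{1}{\Omega_N\,N!^k\,kN}}\in\mathbb{Z}[[z]].$$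
   Context: $H_n=\sum_{i=1}^n1/i$; $v_p$ is the $p$-adic valuation on $\mathbb{Q}$. A Wolstenholme prime is a prime $p$ with $v_p(H_{p-1})\ge3$. For $f\in1+z\mathbb{Q}[[z]]$ and rational $c$, $f^c:=\exp(c\log f)$ as formal power series. *)

theory Defs
  imports
    "HOL-Computational_Algebra.Primes"
    "HOL-Computational_Algebra.Formal_Power_Series"
    "HOL-Number_Theory.Cong"
begin

text \<open>The valuation is only used at nonzero rationals, where it is integer-valued; at \<open>0\<close> the
  formula gives the junk value \<open>0\<close> instead of \<open>\<infinity>\<close>.\<close>

definition rat_val :: "nat \<Rightarrow> rat \<Rightarrow> int" where
  "rat_val p r =
     int (multiplicity (int p) (fst (quotient_of r))) -
     int (multiplicity (int p) (snd (quotient_of r)))"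

definition harmonic :: "nat \<Rightarrow> rat" where
  "harmonic n = (\<Sum>i=1..n. 1 / of_nat i)"

definition wolstenholme_prime :: "nat \<Rightarrow> bool" where
  "wolstenholme_prime p \<longleftrightarrow> prime p \<and> rat_val p (harmonic (p - 1)) \<ge> 3"

definition shifted_harmonic :: "rat \<Rightarrow> nat \<Rightarrow> rat" where
  "shifted_harmonic x m = (\<Sum>n<m. 1 / (x + of_nat n))"

definition F_ser :: "nat \<Rightarrow> nat \<Rightarrow> rat fps" where
  "F_ser N k = Abs_fps (\<lambda>m. fact (N * m) ^ k / fact m ^ (k * N))"

definition G_ser :: "nat \<Rightarrow> nat \<Rightarrow> rat fps" where
  "G_ser N k = fps_const (of_nat k) * Abs_fps (\<lambda>m. if m = 0 then 0 else
     fact (N * m) ^ k / fact m ^ (k * N) *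
     ((\<Sum>j=1..N-1. shifted_harmonic (of_nat j / of_nat N) m)
        - of_nat (N - 1) * shifted_harmonic 1 m))"

text \<open>\<open>fps_exp 1\<close> and \<open>fps_ln 1\<close> are the series of \<open>exp z\<close> and \<open>log (1 + z)\<close>; the
  compositions below are meaningful because the inner series have zero constant term
  (for the power: because \<open>f\<close> has constant term \<open>1\<close>).\<close>

definition q_ser :: "nat \<Rightarrow> nat \<Rightarrow> rat fps" where
  "q_ser N k = fps_X * (fps_exp 1 oo (G_ser N k / F_ser N k))"

definition fps_rat_power :: "rat fps \<Rightarrow> rat \<Rightarrow> rat fps" where
  "fps_rat_power f c = fps_exp 1 oo (fps_const c * (fps_ln 1 oo (f - 1)))"

definition omega :: "nat \<Rightarrow> nat \<Rightarrow> int" where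
  "omega p N =
     (if wolstenholme_prime p \<or> [int N = 1] (mod int p) \<or> [int N = - 1] (mod int p)
      then 1 else 0)"

text \<open>The exponents may be negative, so \<open>Omega N\<close> is in general not an integer.\<close>

definition Omega :: "nat \<Rightarrow> rat" where
  "Omega N =
     (\<Prod>p | prime p \<and> p \<le> N. of_nat p powi min (2 + omega p N) (rat_val p (harmonic N - 1)))"

end

theory Submission
  imports Defs "HOL-Computational_Algebra.Formal_Laurent_Series"
begin

text \<open>Write \<open>b(m) = (N m)! / m!^N\<close> and \<open>D(m) = H_{N m} - H_m\<close>. Then \<open>G = k N \<Sum> b(m)^k D(m) z^m\<close>, and
  it suffices to show for each prime \<open>p\<close> that \<open>exp h\<close> is \<open>p\<close>-integral, where
  \<open>h = (\<Sum> b(m)^k D(m) z^m) / (\<Omega> N!^k F)\<close>. By Dwork's lemma this amounts to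
  \<open>h(z) - h(z^p) / p\<close> being \<open>p\<close>-integral, that is, with \<open>w = v_p(\<Omega>)\<close>, to
  \<open>\<Sum>\<^sub>j b(a + p j)^k b(K - j)^k (D(K - j) - p D(a + p j)) \<in> p^(w + 1) N!^k \<int>_(p)\<close>.
  Replacing \<open>p D(a + p j)\<close> by \<open>D(j)\<close> leaves an antisymmetric sum, which Dwork's congruences for
  \<open>b^k\<close> control after telescoping \<open>D(j)\<close> along the base-\<open>p\<close> digits of \<open>j\<close>.

  Two estimates on \<open>D\<close> remain. The defect \<open>D(p M) - D(M) / p\<close> is congruent to
  \<open>(N^2 - 1) M^2 H_{p-1}\<close> modulo \<open>p^3\<close>; Wolstenholme's theorem then produces the \<open>2 + \<omega>(p, N)\<close>. And
  \<open>b(m) / N! (D(m) - D(p \<lfloor>m / p\<rfloor>)) \<in> p^w \<int>_(p)\<close> for \<open>p\<close> not dividing \<open>m\<close> follows by induction on \<open>m\<close>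
  from \<open>b(m) = b(m - 1) \<Prod>\<^sub>{i \<le> N} (N (m - 1) + i) / m^N\<close>, starting from \<open>D(1) = H_N - 1\<close>: dropping
  one factor from a product of \<open>N\<close> consecutive integers leaves at least \<open>\<lfloor>N / p\<rfloor> - 1\<close> multiples of
  \<open>p\<close>, and \<open>w \<le> max 0 (\<lfloor>N / p\<rfloor> - 1)\<close>, which is in doubt only for \<open>N < 4 p\<close>.\<close>

subsection \<open>Fractional ideals of the integers localized at a prime\<close>

locale p_adic =
  fixes p :: nat
  assumes prime_p: "prime p"
begin

text \<open>The fractional ideal \<open>p^e \<int>_(p)\<close> in the rationals: \<open>x \<in> pid e\<close> means \<open>v_p(x) \<ge> e\<close>.\<close>

definition pid :: "int \<Rightarrow> rat set" where
  "pid e = {x. \<exists>a b :: int. \<not> int p dvd b \<and> x = of_nat p powi e * (of_int a / of_int b)}"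

lemma p_pos [simp]: "p > 0" and p_gt_1: "p > 1" and p_neq_0 [simp]: "p \<noteq> 0"
  using prime_p prime_gt_0_nat prime_gt_1_nat by auto

lemma prime_int_p: "prime (int p)"
  using prime_p by simp

lemma pidI:
  assumes "\<not> int p dvd b" "x = of_nat p powi e * (of_int a / of_int b)"
  shows "x \<in> pid e"
  using assms unfolding pid_def by blast

lemma zero_pid [simp]: "0 \<in> pid e"
  by (rule pidI[of 1 _ _ 0]) (use p_gt_1 in auto)

lemma pid_mult:
  assumes "x \<in> pid e" "y \<in> pid f"
  shows "x * y \<in> pid (e + f)"
proof -
  obtain a b where x: "\<not> int p dvd b" "x = of_nat p powi e * (of_int a / of_int b)"
    using assms(1) unfolding pid_def by auto
  obtain c d where y: "\<not> int p dvd d" "y = of_nat p powi f * (of_int c / of_int d)"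
    using assms(2) unfolding pid_def by auto
  show ?thesis
  proof (rule pidI)
    show "\<not> int p dvd b * d"
      using x y prime_int_p by (simp add: prime_dvd_mult_iff)
    show "x * y = of_nat p powi (e + f) * (of_int (a * c) / of_int (b * d))"
      using x y by (simp add: power_int_add)
  qed
qed

lemma pid_mono:
  assumes "e \<le> f" "x \<in> pid f"
  shows "x \<in> pid e"
proof -
  obtain a b where x: "\<not> int p dvd b" "x = of_nat p powi f * (of_int a / of_int b)"
    using assms(2) unfolding pid_def by auto
  have "(of_nat p :: rat) powi f = of_nat p powi e * of_nat p ^ nat (f - e)"
    using assms(1) power_int_add[of "of_nat p :: rat" e "f - e"] by (simp add: power_int_def)
  with x show ?thesis
    by (intro pidI[of b _ _ "int p ^ nat (f - e) * a"]) auto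
qed

lemma pid_add:
  assumes "x \<in> pid e" "y \<in> pid e"
  shows "x + y \<in> pid e"
proof -
  obtain a b where x: "\<not> int p dvd b" "x = of_nat p powi e * (of_int a / of_int b)"
    using assms(1) unfolding pid_def by auto
  obtain c d where y: "\<not> int p dvd d" "y = of_nat p powi e * (of_int c / of_int d)"
    using assms(2) unfolding pid_def by auto
  have nz: "b \<noteq> 0" "d \<noteq> 0" using x y by auto
  show ?thesis
  proof (rule pidI)
    show "\<not> int p dvd b * d"
      using x y prime_int_p by (simp add: prime_dvd_mult_iff)
    have "of_int a / of_int b + of_int c / of_int d = (of_int (a * d + c * b) / of_int (b * d) :: rat)"
      using nz by (simp add: field_simps)
    then show "x + y = of_nat p powi e * (of_int (a * d + c * b) / of_int (b * d))"
      unfolding x(2) y(2) by (simp only: distrib_left[symmetric])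
  qed
qed

lemma of_int_pid [simp]: "of_int a \<in> pid 0"
  by (rule pidI[of 1 _ _ a]) (use p_gt_1 in auto)

lemma of_nat_pid [simp]: "of_nat a \<in> pid 0"
  using of_int_pid[of "int a"] by simp

lemma one_pid [simp]: "1 \<in> pid 0"
  using of_int_pid[of 1] by simp

lemma numeral_pid [simp]: "numeral k \<in> pid 0"
  using of_int_pid[of "numeral k"] by simp

lemma pid_uminus: "x \<in> pid e \<Longrightarrow> - x \<in> pid e"
  using pid_mult[OF of_int_pid[of "-1"], of x e] by simp

lemma pid_diff: "x \<in> pid e \<Longrightarrow> y \<in> pid e \<Longrightarrow> x - y \<in> pid e"
  using pid_add[OF _ pid_uminus, of x e y] by simp

lemma pid_sum: "(\<And>i. i \<in> I \<Longrightarrow> f i \<in> pid e) \<Longrightarrow> sum f I \<in> pid e"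
  by (induction I rule: infinite_finite_induct) (auto intro: pid_add)

lemma pid_mult0: "x \<in> pid 0 \<Longrightarrow> y \<in> pid e \<Longrightarrow> x * y \<in> pid e"
  using pid_mult[of x 0 y e] by simp

lemma pid_mult0': "x \<in> pid e \<Longrightarrow> y \<in> pid 0 \<Longrightarrow> x * y \<in> pid e"
  using pid_mult[of x e y 0] by simp

lemma pid_prod0: "(\<And>i. i \<in> I \<Longrightarrow> f i \<in> pid 0) \<Longrightarrow> prod f I \<in> pid 0"
  by (induction I rule: infinite_finite_induct) (auto intro: pid_mult0)

lemma pid_power0: "x \<in> pid 0 \<Longrightarrow> x ^ n \<in> pid 0"
  by (induction n) (auto intro: pid_mult0)

lemma p_powi_pid: "of_nat p powi e \<in> pid e"
  by (rule pidI[of 1 _ _ 1]) (use p_gt_1 in auto)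

lemma p_power_pid: "of_nat p ^ n \<in> pid (int n)"
  using p_powi_pid[of "int n"] by simp

lemma p_pid: "of_nat p \<in> pid 1"
  using p_power_pid[of 1] by simp

lemma p_inverse_pid: "inverse (of_nat p) \<in> pid (- 1)"
  using p_powi_pid[of "-1"] by (simp add: power_int_minus)

lemma p_mult_pid_iff: "of_nat p * x \<in> pid e \<longleftrightarrow> x \<in> pid (e - 1)"
proof
  assume "of_nat p * x \<in> pid e"
  from pid_mult[OF p_inverse_pid this] show "x \<in> pid (e - 1)" by (simp add: field_simps)
next
  assume "x \<in> pid (e - 1)"
  from pid_mult[OF p_pid this] show "of_nat p * x \<in> pid e" by simp
qed

lemma p_div_pid_iff: "x / of_nat p \<in> pid e \<longleftrightarrow> x \<in> pid (e + 1)"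
  using p_mult_pid_iff[of "x / of_nat p" "e + 1"] by simp

lemma inverse_of_int_pid: "\<not> int p dvd b \<Longrightarrow> 1 / of_int b \<in> pid 0"
  by (rule pidI[of b _ _ 1]) auto

lemma inverse_of_nat_pid: "\<not> p dvd b \<Longrightarrow> 1 / of_nat b \<in> pid 0"
  using inverse_of_int_pid[of "int b"] by simp

lemma of_int_pid_iff: "of_int a \<in> pid (int n) \<longleftrightarrow> int p ^ n dvd a"
proof
  assume "of_int a \<in> pid (int n)"
  then obtain c b where x: "\<not> int p dvd b" "of_int a = of_nat p powi (int n) * (of_int c / of_int b :: rat)"
    unfolding pid_def by auto
  have "b \<noteq> 0" using x by auto
  with x(2) have "of_int (a * b) = (of_int (int p ^ n * c) :: rat)"
    by (simp add: field_simps)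
  then have "a * b = int p ^ n * c"
    using of_int_eq_iff by blast
  then have "int p ^ n dvd a * b" by simp
  moreover have "coprime (int p ^ n) b"
    using x(1) prime_int_p by (simp add: prime_imp_coprime)
  ultimately show "int p ^ n dvd a"
    using coprime_dvd_mult_left_iff by blast
next
  assume "int p ^ n dvd a"
  then obtain c where "a = int p ^ n * c" by auto
  then show "of_int a \<in> pid (int n)"
    using pid_mult[OF p_power_pid[of n] of_int_pid[of c]] by simp
qed

lemma pid_power_diff:
  assumes "x \<in> pid 0" "y \<in> pid 0" "x - y \<in> pid e"
  shows "x ^ n - y ^ n \<in> pid e"
proof (induction n)
  case (Suc n)
  have "x ^ Suc n - y ^ Suc n = x * (x ^ n - y ^ n) + (x - y) * y ^ n"
    by (simp add: algebra_simps)
  then show ?case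
    using pid_add[OF pid_mult0[OF assms(1) Suc] pid_mult0'[OF assms(3) pid_power0[OF assms(2)]]]
    by simp
qed simp

lemma pid_prod_diff:
  assumes "\<And>i. i \<in> I \<Longrightarrow> f i \<in> pid 0" "\<And>i. i \<in> I \<Longrightarrow> g i \<in> pid 0"
    "\<And>i. i \<in> I \<Longrightarrow> f i - g i \<in> pid e"
  shows "prod f I - prod g I \<in> pid e"
  using assms
proof (induction I rule: infinite_finite_induct)
  case (insert i I)
  have "prod f (insert i I) - prod g (insert i I) =
      f i * (prod f I - prod g I) + (f i - g i) * prod g I"
    using insert by (simp add: algebra_simps)
  moreover have "f i * (prod f I - prod g I) \<in> pid e" "(f i - g i) * prod g I \<in> pid e"
    using insert by (auto intro!: pid_mult0[of "f i"] pid_mult0'[of "f i - g i"] pid_prod0)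
  ultimately show ?case
    using pid_add by presburger
qed auto

lemma pid_inverse_diff:
  assumes "1 / x \<in> pid 0" "1 / y \<in> pid 0" "x - y \<in> pid e" "x \<noteq> 0" "y \<noteq> 0"
  shows "1 / x - 1 / y \<in> pid e"
proof -
  have "1 / x - 1 / y = (1 / x) * (1 / y) * - (x - y)"
    using assms(4,5) by (simp add: field_simps)
  then show ?thesis
    using assms by (metis pid_mult0 pid_uminus)
qed

text \<open>The junk value of \<open>rat_val\<close> at \<open>0\<close> does no harm, because
  \<open>0\<close> lies in every \<open>pid e\<close>. Otherwise the powers of \<open>p\<close> are
  split off numerator and denominator.\<close>

lemma rat_val_pid:
  assumes "e \<le> rat_val p x"
  shows "x \<in> pid e"
proof (cases "x = 0")
  case False
  obtain a b where q: "quotient_of x = (a, b)" by force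
  have x: "x = of_int a / of_int b" and b: "b > 0"
    using quotient_of_div[OF q] quotient_of_denom_pos[OF q] by auto
  have "a \<noteq> 0" using x False by auto
  have nu: "\<not> is_unit (int p)" using prime_int_p not_prime_unit by blast
  define \<alpha> where "\<alpha> = multiplicity (int p) a"
  define \<beta> where "\<beta> = multiplicity (int p) b"
  obtain a' where a': "a = int p ^ \<alpha> * a'" "\<not> int p dvd a'"
    using multiplicity_decompose'[OF \<open>a \<noteq> 0\<close> nu] \<alpha>_def by blast
  have "b \<noteq> 0" using b by simp
  obtain b' where b': "b = int p ^ \<beta> * b'" "\<not> int p dvd b'"
    using multiplicity_decompose'[OF \<open>b \<noteq> 0\<close> nu] \<beta>_def by blast
  have "e \<le> int \<alpha> - int \<beta>"
    using assms q unfolding rat_val_def \<alpha>_def \<beta>_def by simp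
  moreover have "x = of_nat p powi (int \<alpha> - int \<beta>) * (of_int a' / of_int b')"
    unfolding x a'(1) b'(1) by (simp add: power_int_diff)
  then have "x \<in> pid (int \<alpha> - int \<beta>)"
    using b'(2) by (rule pidI[rotated])
  ultimately show ?thesis using pid_mono by blast
qed simp

end

text \<open>A prime dividing the reduced denominator would contradict integrality at that prime.
  This lets the theorem be proved one prime at a time.\<close>

lemma Ints_if_all_p_adic:
  assumes "\<And>p. prime p \<Longrightarrow> x \<in> p_adic.pid p 0"
  shows "x \<in> \<int>"
proof -
  obtain a b where q: "quotient_of x = (a, b)" by force
  have x: "x = of_int a / of_int b" and b: "b > 0" and cop: "coprime a b"
    using quotient_of_div[OF q] quotient_of_denom_pos[OF q] quotient_of_coprime[OF q] by auto
  have "b = 1"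
  proof (rule ccontr)
    assume "b \<noteq> 1"
    then obtain r :: int where r: "prime r" "r dvd b"
      using b \<open>b \<noteq> 1\<close> prime_divisor_exists[of b] by (auto simp: zdvd1_eq)
    then have r0: "r \<ge> 0" using prime_ge_0_int by blast
    define p where "p = nat r"
    have p: "prime p" "int p dvd b"
      using r r0 unfolding p_def by simp_all
    interpret p_adic p by standard (rule p(1))
    obtain c d where cd: "\<not> int p dvd d" "x = of_int c / of_int d"
      using assms[OF p(1)] unfolding pid_def by auto
    have "d \<noteq> 0" using cd by auto
    then have "of_int (a * d) = (of_int (c * b) :: rat)"
      using x cd(2) b by (simp add: field_simps)
    then have "a * d = c * b" using of_int_eq_iff by blast
    then have "int p dvd a * d" using p(2) by simp
    then have "int p dvd a" using cd(1) prime_int_p prime_dvd_mult_iff by blast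
    then have "is_unit (int p)" using cop p(2) coprime_common_divisor by blast
    then show False using prime_int_p not_prime_unit by blast
  qed
  then show ?thesis using x by simp
qed

subsection \<open>Dwork's integrality criterion for exponentials\<close>

abbreviation fps_exp_of :: "rat fps \<Rightarrow> rat fps" where
  "fps_exp_of h \<equiv> fps_exp 1 oo h"

text \<open>The equation expresses \<open>f $ Suc m\<close> through lower coefficients. Serves as a
  uniqueness principle for identities between exponentials.\<close>

lemma fps_linear_ODE_zero:
  fixes f :: "rat fps"
  assumes "fps_deriv f = u * f" "f $ 0 = 0"
  shows "f = 0"
proof (rule fps_ext)
  fix n show "f $ n = 0 $ n"
  proof (induction n rule: less_induct)
    case (less n)
    show ?case
    proof (cases n)
      case (Suc m)
      have "of_nat (Suc m) * f $ Suc m = (u * f) $ m"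
        using assms(1) by (metis fps_deriv_nth Suc_eq_plus1)
      also have "\<dots> = 0"
        unfolding fps_mult_nth using less Suc by (intro sum.neutral) auto
      finally show ?thesis using Suc by (simp del: of_nat_Suc)
    qed (use assms in simp)
  qed
qed

text \<open>Both sides have logarithmic derivative \<open>fps_deriv h + fps_deriv g\<close>, so
  their difference solves a linear equation with zero initial value.\<close>

lemma fps_exp_of_add:
  assumes "h $ 0 = 0" "g $ 0 = 0"
  shows "fps_exp_of (h + g) = fps_exp_of h * fps_exp_of g"
proof -
  have "fps_exp_of (h + g) - fps_exp_of h * fps_exp_of g = 0"
    by (rule fps_linear_ODE_zero[where u = "fps_deriv h + fps_deriv g"])
      (use assms in \<open>simp_all add: fps_compose_deriv algebra_simps\<close>)
  then show ?thesis by simp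
qed

lemma fps_exp_of_power:
  assumes "h $ 0 = 0"
  shows "fps_exp_of h ^ n = fps_exp_of (of_nat n * h)"
proof (induction n)
  case (Suc n)
  then show ?case
    using assms fps_exp_of_add[of h "of_nat n * h"] by (simp add: algebra_simps)
qed simp

text \<open>This identifies the power \<open>f^c\<close> of \<open>f = exp h\<close> with
  \<open>exp (c h)\<close>.\<close>

lemma fps_ln_fps_exp_of:
  assumes "h $ 0 = 0"
  shows "fps_ln 1 oo (fps_exp_of h - 1) = h"
proof -
  have "fps_exp_of h - 1 = (fps_exp 1 - 1) oo h"
    by (simp add: fps_compose_sub_distrib)
  then have "fps_ln 1 oo (fps_exp_of h - 1) = (fps_ln 1 oo (fps_exp 1 - 1)) oo h"
    using assms by (simp add: fps_compose_assoc)
  also have "fps_ln 1 oo (fps_exp 1 - 1) = (fps_X :: rat fps)"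
    by (simp add: fps_ln_fps_exp_inv fps_inv_fps_exp_compose)
  finally show ?thesis using assms by simp
qed

section \<open>Power series with \<open>p\<close>-integral coefficients, and Dwork's lemma\<close>

context p_adic
begin

definition pfps :: "int \<Rightarrow> rat fps set" where
  "pfps e = {f. \<forall>n. f $ n \<in> pid e}"

lemma pfpsD: "f \<in> pfps e \<Longrightarrow> f $ n \<in> pid e"
  by (simp add: pfps_def)

lemma pfps_mult: "f \<in> pfps d \<Longrightarrow> g \<in> pfps e \<Longrightarrow> f * g \<in> pfps (d + e)"
  unfolding pfps_def by (auto simp: fps_mult_nth intro!: pid_sum pid_mult)

lemma pfps_mult0: "f \<in> pfps 0 \<Longrightarrow> g \<in> pfps e \<Longrightarrow> f * g \<in> pfps e"
  using pfps_mult[of f 0 g e] by simp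

lemma pfps_add: "f \<in> pfps e \<Longrightarrow> g \<in> pfps e \<Longrightarrow> f + g \<in> pfps e"
  unfolding pfps_def by (auto intro: pid_add)

lemma pfps_const [simp]: "fps_const c \<in> pfps e \<longleftrightarrow> c \<in> pid e"
  unfolding pfps_def by auto

lemma pfps_one [simp]: "1 \<in> pfps 0"
  unfolding pfps_def by auto

lemma pfps_X_power [simp]: "fps_X ^ n \<in> pfps 0"
  unfolding pfps_def by (auto simp: fps_X_power_nth)

lemma pfps_power: "f \<in> pfps 0 \<Longrightarrow> f ^ n \<in> pfps 0"
  by (induction n) (auto intro: pfps_mult0)

lemma pfps_sum: "(\<And>i. i \<in> I \<Longrightarrow> f i \<in> pfps e) \<Longrightarrow> sum f I \<in> pfps e"
  unfolding pfps_def by (auto simp: fps_sum_nth intro: pid_sum)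

text \<open>Since the constant term is \<open>1\<close>, the recursion for the coefficients of the
  inverse involves no division.\<close>

lemma pfps_inverse:
  assumes f: "f \<in> pfps 0" "f $ 0 = 1"
  shows "inverse f \<in> pfps 0"
  unfolding pfps_def
proof safe
  fix n show "inverse f $ n \<in> pid 0"
  proof (induction n rule: less_induct)
    case (less n)
    show ?case
    proof (cases "n = 0")
      case False
      have "f * inverse f = 1"
        using f by (simp add: inverse_mult_eq_1' )
      then have "0 = (f * inverse f) $ n" using False by simp
      also have "\<dots> = (\<Sum>i\<in>{0..n}. f $ i * inverse f $ (n - i))"
        by (simp add: fps_mult_nth)
      also have "\<dots> = inverse f $ n + (\<Sum>i\<in>{0..n} - {0}. f $ i * inverse f $ (n - i))"
        using f by (subst sum.remove[of _ 0]) auto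
      finally have "inverse f $ n = - (\<Sum>i\<in>{0..n} - {0}. f $ i * inverse f $ (n - i))"
        by (simp add: eq_neg_iff_add_eq_0)
      also have "\<dots> \<in> pid 0"
        using less f(1) by (intro pid_uminus pid_sum pid_mult0) (auto intro: pfpsD)
      finally show ?thesis .
    qed (use f in simp)
  qed
qed

lemma pfps_frobenius: "f \<in> pfps e \<Longrightarrow> f oo fps_X ^ p \<in> pfps e"
  unfolding pfps_def by (auto simp: fps_nth_compose_X_power)

lemma p_dvd_pid:
  assumes "p dvd c"
  shows "of_nat c \<in> pid 1"
  using assms of_int_pid_iff[of "int c" 1] by simp

lemma pfps_freshmans_dream:
  assumes "f \<in> pfps 0" "g \<in> pfps 0"
  shows "(f + g) ^ p - (f ^ p + g ^ p) \<in> pfps 1"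
proof -
  let ?t = "\<lambda>k. of_nat (p choose k) * f ^ k * g ^ (p - k)"
  have "(f + g) ^ p = (\<Sum>k\<in>{..p}. ?t k)"
    by (simp add: binomial_ring)
  also have "{..p} = insert 0 (insert p {0<..<p})"
    using p_pos by auto
  also have "sum ?t \<dots> = f ^ p + g ^ p + (\<Sum>k\<in>{0<..<p}. ?t k)"
    using p_pos by simp
  finally have "(f + g) ^ p - (f ^ p + g ^ p) = (\<Sum>k\<in>{0<..<p}. ?t k)" by simp
  also have "\<dots> \<in> pfps 1"
  proof (rule pfps_sum)
    fix k assume k: "k \<in> {0<..<p}"
    then have "p dvd (p choose k)"
      using prime_p by (intro dvd_choose_prime) auto
    then have "fps_const (of_nat (p choose k)) \<in> pfps 1"
      by (simp add: p_dvd_pid)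
    then have "of_nat (p choose k) \<in> pfps 1"
      by (simp add: fps_of_nat)
    then have "f ^ k * g ^ (p - k) * of_nat (p choose k) \<in> pfps 1"
      using assms by (intro pfps_mult0 pfps_power)
    then show "?t k \<in> pfps 1"
      by (simp add: mult_ac)
  qed
  finally show ?thesis .
qed

lemma pid_freshmans_dream:
  assumes "x \<in> pid 0" "y \<in> pid 0"
  shows "(x + y) ^ p - (x ^ p + y ^ p) \<in> pid 1"
  using pfps_freshmans_dream[of "fps_const x" "fps_const y"] assms
  by (simp add: fps_const_power)

text \<open>Natural numbers by induction with the freshman's dream, integers by reduction modulo
  \<open>p\<close>, fractions by clearing the denominator.\<close>

lemma pid_fermat:
  assumes "x \<in> pid 0"
  shows "x ^ p - x \<in> pid 1"
proof -
  have nat: "of_nat a ^ p - of_nat a \<in> pid 1" for a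
  proof (induction a)
    case (Suc a)
    have "of_nat (Suc a) ^ p - of_nat (Suc a) =
      (of_nat a + 1) ^ p - (of_nat a ^ p + 1 ^ p) + (of_nat a ^ p - (of_nat a :: rat))"
      by (simp add: add.commute)
    also have "\<dots> \<in> pid 1"
      by (rule pid_add[OF pid_freshmans_dream Suc]) auto
    finally show ?case .
  qed (use p_pos in \<open>simp add: power_0_left\<close>)
  have int: "of_int a ^ p - of_int a \<in> pid 1" for a
  proof -
    define c where "c = nat (a mod int p)"
    have "int p dvd a - int c"
      unfolding c_def by (simp add: mod_eq_dvd_iff[symmetric])
    then have c: "of_int (a - int c) \<in> pid 1"
      using of_int_pid_iff[of "a - int c" 1] by simp
    then have "of_int a ^ p - of_int (int c) ^ p \<in> pid 1"
      by (intro pid_power_diff) auto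
    from pid_diff[OF pid_add[OF this nat[of c]] c] show ?thesis by simp
  qed
  obtain a b where ab: "\<not> int p dvd b" "x = of_int a / of_int b"
    using assms unfolding pid_def by auto
  have b: "(of_int b :: rat) \<noteq> 0" using ab(1) by auto
  have "x ^ p - x = (1 / of_int b) ^ Suc p *
      ((of_int a ^ p - of_int a) * of_int b - of_int a * (of_int b ^ p - of_int b))"
    unfolding ab(2) using b by (simp add: field_simps)
  also have "\<dots> \<in> pid 1"
    by (intro pid_mult0 pid_power0 inverse_of_int_pid ab(1) pid_diff int
        pid_mult0[OF of_int_pid int] pid_mult0'[OF int of_int_pid])
  finally show ?thesis .
qed

text \<open>Adding one monomial at a time reduces the claim to the freshman's dream and to Fermat's
  little theorem for the coefficients.\<close>

lemma pfps_frobenius_partial_sum: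
  assumes "f \<in> pfps 0"
  defines "T \<equiv> \<lambda>n. (\<Sum>i<n. fps_const (f $ i) * fps_X ^ i)"
  shows "T n ^ p - (T n oo fps_X ^ p) \<in> pfps 1"
proof (induction n)
  case 0
  show ?case using p_pos by (simp add: T_def power_0_left pfps_def)
next
  case (Suc n)
  let ?m = "fps_const (f $ n) * fps_X ^ n"
  have Tn: "T n \<in> pfps 0"
    unfolding T_def using assms by (intro pfps_sum pfps_mult0) (auto intro: pfpsD)
  have m: "?m \<in> pfps 0"
    using assms by (intro pfps_mult0) (auto intro: pfpsD)
  have X0: "(fps_X ^ p :: rat fps) $ 0 = 0" using p_pos by (simp add: fps_X_power_nth)
  have mf: "?m oo fps_X ^ p = fps_const (f $ n) * fps_X ^ (n * p)"
    using X0 by (simp add: fps_compose_mult_distrib fps_X_power_compose power_mult[symmetric] mult.commute)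
  have mp: "?m ^ p = fps_const ((f $ n) ^ p) * fps_X ^ (n * p)"
    by (simp add: power_mult_distrib fps_const_power flip: power_mult)
  have "?m ^ p - (?m oo fps_X ^ p) = fps_X ^ (n * p) * fps_const ((f $ n) ^ p - f $ n)"
    unfolding mf mp by (simp add: algebra_simps flip: fps_const_sub)
  also have "\<dots> \<in> pfps 1"
    using assms by (intro pfps_mult0) (auto intro: pid_fermat pfpsD)
  finally have d: "?m ^ p - (?m oo fps_X ^ p) \<in> pfps 1" .
  have "T (Suc n) ^ p - (T (Suc n) oo fps_X ^ p) =
     ((T n + ?m) ^ p - (T n ^ p + ?m ^ p)) + (T n ^ p - (T n oo fps_X ^ p)) + (?m ^ p - (?m oo fps_X ^ p))"
    by (simp add: T_def fps_compose_add_distrib)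
  also have "\<dots> \<in> pfps 1"
    by (intro pfps_add pfps_freshmans_dream Suc Tn m d)
  finally show ?case .
qed

text \<open>Up to sign this is the value of Morita's \<open>p\<close>-adic gamma function at
  \<open>x + 1\<close>.\<close>

definition p_free_fact :: "nat \<Rightarrow> nat" where
  "p_free_fact x = (\<Prod>i\<in>{i\<in>{1..x}. \<not> p dvd i}. i)"

lemma p_free_fact_0 [simp]: "p_free_fact 0 = 1"
  by (simp add: p_free_fact_def)

lemma p_free_fact_Suc:
  "p_free_fact (Suc x) = p_free_fact x * (if p dvd Suc x then 1 else Suc x)"
proof -
  have "{i\<in>{1..Suc x}. \<not> p dvd i} =
    (if p dvd Suc x then {i\<in>{1..x}. \<not> p dvd i} else insert (Suc x) {i\<in>{1..x}. \<not> p dvd i})"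
    by (auto simp: le_Suc_eq)
  then show ?thesis unfolding p_free_fact_def by simp
qed

lemma not_dvd_p_free_fact: "\<not> p dvd p_free_fact x"
  using p_gt_1 prime_p by (induction x) (auto simp: p_free_fact_Suc prime_dvd_mult_iff)

text \<open>The multiples of \<open>p\<close> up to \<open>x\<close> are \<open>p\<close> times the
  numbers up to \<open>x div p\<close>.\<close>

lemma fact_p_free_fact:
  "fact x = p_free_fact x * p ^ (x div p) * fact (x div p)"
proof (induction x)
  case (Suc x)
  show ?case
  proof (cases "p dvd Suc x")
    case True
    then have "Suc x div p = Suc (x div p)" by (simp add: div_Suc mod_eq_0_iff_dvd)
    moreover from this True have "fact (Suc x) = p * Suc (x div p) * fact x"
      by (metis dvd_mult_div_cancel fact_Suc of_nat_id)
    moreover have "p_free_fact (Suc x) = p_free_fact x"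
      using True by (simp add: p_free_fact_Suc)
    ultimately show ?thesis using Suc
      by (simp only: power_Suc fact_Suc mult_ac of_nat_id)
  next
    case False
    then have "Suc x div p = x div p" by (simp add: div_Suc mod_eq_0_iff_dvd)
    then show ?thesis using Suc False by (simp add: p_free_fact_Suc algebra_simps)
  qed
qed simp

lemma fact_p_free_fact_rat:
  "fact x = (of_nat (p_free_fact x) * of_nat p ^ (x div p) * fact (x div p) :: rat)"
  using arg_cong[OF fact_p_free_fact[of x], of "of_nat :: nat \<Rightarrow> rat"] by simp

text \<open>With \<open>c = n div p\<close>, \<open>n!\<close> is a unit times
  \<open>p^c c!\<close>. As \<open>2 c <= n\<close>, two copies of \<open>p^c\<close> fit into
  \<open>p^n\<close>: one cancels the power, the other is paired with \<open>c!\<close> by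
  induction.\<close>

lemma p_power_div_fact_pid:
  assumes "n > 0"
  shows "of_nat p ^ n / fact n \<in> pid 1"
  using assms
proof (induction n rule: less_induct)
  case (less n)
  let ?c = "n div p"
  have inv: "1 / of_nat (p_free_fact n) \<in> pid 0"
    by (rule inverse_of_nat_pid[OF not_dvd_p_free_fact])
  have nz: "of_nat (p_free_fact n) \<noteq> (0 :: rat)"
    using not_dvd_p_free_fact[of n] by (metis dvd_0_right of_nat_eq_0_iff)
  show ?case
  proof (cases "?c = 0")
    case True
    have "of_nat p ^ n / fact n = (1 / of_nat (p_free_fact n)) * (of_nat p ^ n :: rat)"
      by (subst fact_p_free_fact_rat) (simp add: True)
    also have "\<dots> \<in> pid 1"
      using inv pid_mono[OF _ p_power_pid[of n], of 1] less.prems by (intro pid_mult0) auto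
    finally show ?thesis .
  next
    case False
    have le: "?c + ?c \<le> n"
    proof -
      have "2 * ?c \<le> p * ?c" using p_gt_1 by (intro mult_right_mono) auto
      also have "\<dots> \<le> n" by simp
      finally show ?thesis by simp
    qed
    have "of_nat p ^ n / fact n =
       (1 / of_nat (p_free_fact n)) * (of_nat p ^ (n - (?c + ?c)) * (of_nat p ^ ?c / fact ?c :: rat))"
    proof -
      have "(of_nat p :: rat) ^ n = of_nat p ^ (n - (?c + ?c)) * of_nat p ^ ?c * of_nat p ^ ?c"
        using le by (simp flip: power_add)
      then show ?thesis
        by (subst fact_p_free_fact_rat[of n]) (simp add: nz)
    qed
    also have "\<dots> \<in> pid 1"
      using False less.IH[of ?c] less.prems p_gt_1
      by (intro pid_mult0 inv pid_power0) auto
    finally show ?thesis .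
  qed
qed

text \<open>The term \<open>(p g)^i / i!\<close> carries the factor \<open>p^i / i!\<close>, which
  lies in \<open>pid 1\<close> for \<open>i > 0\<close>; the term \<open>i = 0\<close> contributes
  only to the constant coefficient.\<close>

lemma fps_exp_of_p_mult:
  assumes g: "g \<in> pfps 0" "g $ 0 = 0" and n: "n > 0"
  shows "fps_exp_of (of_nat p * g) $ n \<in> pid 1"
proof -
  have "fps_exp_of (of_nat p * g) $ n = (\<Sum>i\<in>{0..n}. (1 / fact i) * ((of_nat p * g) ^ i $ n))"
    by (simp add: fps_compose_nth)
  also have "\<dots> \<in> pid 1"
  proof (rule pid_sum)
    fix i
    have "(1 / fact i) * ((of_nat p * g) ^ i $ n) = g ^ i $ n * (of_nat p ^ i / fact i)"
      by (simp add: power_mult_distrib fps_of_nat[symmetric] fps_const_power)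
    also have "\<dots> \<in> pid 1"
    proof (cases "i = 0")
      case False
      then show ?thesis
        using g by (intro pid_mult0 p_power_div_fact_pid pfpsD pfps_power) auto
    qed (use n in simp)
    finally show "(1 / fact i) * ((of_nat p * g) ^ i $ n) \<in> pid 1" .
  qed
  finally show ?thesis .
qed

text \<open>With \<open>e = exp h\<close> and \<open>g\<close> the difference in the hypothesis,
  \<open>e(X)^p = e(X^p) W\<close> for \<open>W = exp (p g)\<close>, which is \<open>1\<close>
  modulo \<open>p\<close>. Comparing coefficients of \<open>X^n\<close> modulo \<open>p\<close>
  yields integrality of \<open>e $ n\<close> from that of the lower ones.\<close>

lemma dwork_exp_integral:
  assumes h0: "h $ 0 = 0"
    and g: "h - fps_const (1 / of_nat p) * (h oo fps_X ^ p) \<in> pfps 0"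
  shows "fps_exp_of h \<in> pfps 0"
proof -
  define e where "e = fps_exp_of h"
  define g where "g = h - fps_const (1 / of_nat p) * (h oo fps_X ^ p)"
  define W where "W = fps_exp_of (of_nat p * g)"
  have X0: "(fps_X ^ p :: rat fps) $ 0 = 0" using p_pos by (simp add: fps_X_power_nth)
  have g0: "g $ 0 = 0" using h0 by (simp add: g_def)
  have e0: "e $ 0 = 1" and W0: "W $ 0 = 1"
    by (simp_all add: e_def W_def)
  have hX0: "(h oo fps_X ^ p) $ 0 = 0" using h0 by simp
  have "fps_const (of_nat p) * fps_const (1 / of_nat p) = (1 :: rat fps)"
    by simp
  then have "of_nat p * fps_const (1 / of_nat p) = (1 :: rat fps)"
    by (simp only: fps_of_nat)
  then have "of_nat p * g = of_nat p * h - (h oo fps_X ^ p)"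
    by (simp only: g_def right_diff_distrib mult.assoc[symmetric] mult_1_left)
  then have "of_nat p * h = (h oo fps_X ^ p) + of_nat p * g"
    by simp
  then have "e ^ p = fps_exp_of (h oo fps_X ^ p) * W"
    unfolding e_def W_def fps_exp_of_power[OF h0]
    using fps_exp_of_add[OF hX0, of "of_nat p * g"] g0 by simp
  also have "fps_exp_of (h oo fps_X ^ p) = e oo fps_X ^ p"
    unfolding e_def by (rule fps_compose_assoc[OF X0 h0])
  finally have ep: "e ^ p = (e oo fps_X ^ p) * W" .
  have "e $ n \<in> pid 0" for n
  proof (induction n rule: less_induct)
    case (less n)
    show ?case
    proof (cases "n = 0")
      case False
      \<comment> \<open>\<open>f\<close> and \<open>T\<close> are both \<open>e\<close> cut off
        below degree \<open>n\<close>, where integrality is known by induction.\<close>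
      define f where "f = Abs_fps (\<lambda>i. if i < n then e $ i else 0)"
      define T where "T = (\<Sum>i<n. fps_const (f $ i) * fps_X ^ i)"
      have fin: "f \<in> pfps 0"
        using less unfolding f_def pfps_def by auto
      have Tn: "T $ i = (if i < n then e $ i else 0)" for i
        unfolding T_def f_def by (simp add: fps_sum_nth if_distrib cong: if_cong)
      define r where "r = fps_shift n (e - T)"
      have "e - T = fps_X ^ n * r"
        unfolding r_def by (rule fps_ext) (auto simp: Tn fps_X_power_mult_nth)
      \<comment> \<open>In degree \<open>n\<close> the product contributes \<open>e $ n\<close>
        times the constant term of the cofactor, which is \<open>p\<close> because \<open>e\<close>
        and \<open>T\<close> have constant term \<open>1\<close>.\<close>
      then have "e ^ p - T ^ p = fps_X ^ n * (r * (\<Sum>i<p. T ^ (p - Suc i) * e ^ i))"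
        by (simp add: power_diff_sumr2 mult.assoc)
      then have "(e ^ p - T ^ p) $ n = (r * (\<Sum>i<p. T ^ (p - Suc i) * e ^ i)) $ 0"
        by (simp add: fps_X_power_mult_nth)
      also have "\<dots> = of_nat p * e $ n"
        using False e0 by (simp add: r_def Tn fps_sum_nth fps_power_zeroth)
      finally have lhs: "(e ^ p) $ n = (T ^ p) $ n + of_nat p * e $ n" by simp
      have div: "i div p < n" if "i \<le> n" for i
        using that False p_gt_1 by (metis div_le_mono div_less_dividend le_less_trans not_gr_zero)
      \<comment> \<open>As \<open>n div p < n\<close>, substituting \<open>X^p\<close> sees only
        coefficients of \<open>e\<close> below degree \<open>n\<close>.\<close>
      have TX: "(e oo fps_X ^ p) $ n = (T oo fps_X ^ p) $ n"
        using div[of n] by (simp add: fps_nth_compose_X_power Tn)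
      have "(e ^ p) $ n = (\<Sum>i\<in>{0..n}. (e oo fps_X ^ p) $ i * W $ (n - i))"
        unfolding ep by (simp add: fps_mult_nth)
      also have "\<dots> = (e oo fps_X ^ p) $ n + (\<Sum>i\<in>{0..n} - {n}. (e oo fps_X ^ p) $ i * W $ (n - i))"
        by (subst sum.remove[of _ n]) (auto simp: W0)
      finally have rhs: "(e ^ p) $ n =
        (T oo fps_X ^ p) $ n + (\<Sum>i\<in>{0..n} - {n}. (e oo fps_X ^ p) $ i * W $ (n - i))"
        using TX by simp
      have s: "(\<Sum>i\<in>{0..n} - {n}. (e oo fps_X ^ p) $ i * W $ (n - i)) \<in> pid 1"
      proof (rule pid_sum)
        fix i assume i: "i \<in> {0..n} - {n}"
        have "(e oo fps_X ^ p) $ i \<in> pid 0"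
          using less[of "i div p"] div[of i] i by (auto simp: fps_nth_compose_X_power)
        moreover have "W $ (n - i) \<in> pid 1"
          unfolding W_def using i g g0 by (intro fps_exp_of_p_mult) (auto simp: g_def)
        ultimately show "(e oo fps_X ^ p) $ i * W $ (n - i) \<in> pid 1" by (rule pid_mult0)
      qed
      have "(T ^ p - (T oo fps_X ^ p)) $ n \<in> pid 1"
        unfolding T_def by (rule pfpsD[OF pfps_frobenius_partial_sum[OF fin]])
      from pid_diff[OF s this] have "of_nat p * e $ n \<in> pid 1"
        using lhs rhs by (simp add: algebra_simps)
      then show ?thesis by (simp add: p_mult_pid_iff)
    qed (simp add: e0)
  qed
  then show ?thesis unfolding e_def pfps_def by blast
qed

end

subsection \<open>Dwork's congruences\<close>

text \<open>\<open>A_cong\<close> is Dwork's hypothesis that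
  \<open>A (v + p u + m p^(s+1)) / A (v + p u)\<close> is close to
  \<open>A (u + m p^s) / A u\<close>, with \<open>A (v + p u) / A m\<close> as weight.\<close>

locale dwork_sequence = p_adic +
  fixes A :: "nat \<Rightarrow> rat"
  assumes A_nonzero: "A n \<noteq> 0"
    and A_0: "A 0 = 1"
    and A_integral: "A n \<in> pid 0"
    and A_cong: "v < p \<Longrightarrow> u < p ^ s \<Longrightarrow>
      (A (v + p * u + m * p ^ Suc s) - A (v + p * u) * A (u + m * p ^ s) / A u) / A m \<in> pid (int (Suc s))"
begin

definition Aint :: "int \<Rightarrow> rat" where
  "Aint i = (if i < 0 then 0 else A (nat i))"

text \<open>Dwork's sums. Extending \<open>A\<close> by zero to negative arguments makes the terms with \<open>j > K\<close> vanish,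
  so that sums may be taken over full blocks of length \<open>p^s\<close>.\<close>

definition dterm :: "nat \<Rightarrow> int \<Rightarrow> nat \<Rightarrow> rat" where
  "dterm a K j = A (a + p * j) * Aint (K - int j) - A j * Aint (int a + int p * (K - int j))"

definition dsum :: "nat \<Rightarrow> int \<Rightarrow> nat \<Rightarrow> nat \<Rightarrow> rat" where
  "dsum a K s m = (\<Sum>j<p ^ s. dterm a K (j + m * p ^ s))"

lemma Aint_integral: "Aint i \<in> pid 0"
  by (simp add: Aint_def A_integral)

text \<open>\<open>a < p\<close> makes \<open>a + p (K - j)\<close> negative together with
  \<open>K - j\<close>, so both products contain a vanishing value of \<open>Aint\<close>.\<close>

lemma dterm_beyond:
  assumes "a < p" "K < int j"
  shows "dterm a K j = 0"
proof -
  have "int p * (K - int j) \<le> int p * (-1)"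
    using assms by (intro mult_left_mono) auto
  then have "int a + int p * (K - int j) < 0" using assms by simp
  then show ?thesis using assms by (simp add: dterm_def Aint_def)
qed

lemma dsum_negative: "a < p \<Longrightarrow> K < 0 \<Longrightarrow> dsum a K s m = 0"
  unfolding dsum_def by (intro sum.neutral ballI dterm_beyond order.strict_trans2[OF _ of_nat_0_le_iff])

lemma sum_blocks: "(\<Sum>i<n * k. f i) = (\<Sum>m<n. \<Sum>j<k. f (j + m * k))" for k :: nat and f :: "nat \<Rightarrow> 'b :: comm_monoid_add"
proof -
  have "sum f {m * k..<m * k + k} = (\<Sum>j<k. f (j + m * k))" for m
    using sum.shift_bounds_nat_ivl[of f 0 "m * k" k] by (simp add: atLeast0LessThan add.commute)
  then show ?thesis using sum.nat_group[of f k n] by simp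
qed

lemma dsum_Suc: "dsum a K (Suc s) u = (\<Sum>v<p. dsum a K s (v + p * u))"
proof -
  have "dsum a K (Suc s) u = (\<Sum>j<p * p ^ s. dterm a K (j + u * p ^ Suc s))"
    by (simp add: dsum_def)
  also have "\<dots> = (\<Sum>v<p. dsum a K s (v + p * u))"
    unfolding sum_blocks dsum_def by (simp add: algebra_simps)
  finally show ?thesis .
qed

lemma sum_dterm: "(\<Sum>m<n. dsum a K s m) = (\<Sum>j<n * p ^ s. dterm a K j)"
  unfolding sum_blocks dsum_def ..

lemma dterm_eq:
  assumes "j \<le> K"
  shows "dterm a (int K) j = A (a + p * j) * A (K - j) - A j * A (a + p * (K - j))"
proof -
  have "int a + int p * (int K - int j) = int (a + p * (K - j))"
    using assms by (simp add: of_nat_diff)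
  then show ?thesis
    using assms by (simp add: dterm_def Aint_def nat_diff_distrib del: of_nat_add of_nat_mult)
qed

text \<open>The reflection of \<open>j\<close> to \<open>K - j\<close> interchanges the two products
  in \<open>dterm\<close>.\<close>

lemma sum_dterm_zero: "(\<Sum>j\<le>K. dterm a (int K) j) = 0"
proof -
  have "(\<Sum>j\<le>K. A (a + p * j) * A (K - j)) = (\<Sum>j\<le>K. A (a + p * (K - j)) * A j)"
    by (rule sum.reindex_bij_witness[of _ "\<lambda>j. K - j" "\<lambda>j. K - j"]) auto
  then show ?thesis
    by (simp add: dterm_eq sum_subtractf mult.commute)
qed

lemma sum_dterm_all_zero:
  assumes "a < p" "int n > K"
  shows "(\<Sum>j<n. dterm a K j) = 0"
proof (cases "K < 0")
  case True
  then show ?thesis using assms by (intro sum.neutral ballI dterm_beyond) auto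
next
  case False
  have "(\<Sum>j<n. dterm a K j) = (\<Sum>j\<le>nat K. dterm a K j)"
    using False assms by (intro sum.mono_neutral_right) (auto intro!: dterm_beyond)
  then show ?thesis using sum_dterm_zero[where K = "nat K" and a = a] False by simp
qed

text \<open>Termwise, the parts containing \<open>Aint (a + p (K - j))\<close> cancel, and
  \<open>A_cong\<close> with \<open>v = a\<close>, \<open>u = j\<close> bounds what remains.\<close>

lemma dsum_shift_0:
  assumes "a < p"
  shows "(dsum a (K + int (m * p ^ s)) s m -
    (\<Sum>j<p ^ s. A (j + m * p ^ s) / A j * dsum a K 0 j)) / A m \<in> pid (int (Suc s))"
proof -
  let ?c = "\<lambda>j. (A (a + p * j + m * p ^ Suc s) - A (a + p * j) * A (j + m * p ^ s) / A j) / A m"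
  have "dterm a (K + int (m * p ^ s)) (j + m * p ^ s) - A (j + m * p ^ s) / A j * dterm a K j =
      Aint (K - int j) * (A (a + p * j + m * p ^ Suc s) - A (a + p * j) * A (j + m * p ^ s) / A j)" for j
  proof -
    have "a + p * (j + m * p ^ s) = a + p * j + m * p ^ Suc s"
      by (simp add: algebra_simps)
    then show ?thesis
      using A_nonzero[of j] unfolding dterm_def by (simp add: field_simps)
  qed
  then have "(dsum a (K + int (m * p ^ s)) s m -
    (\<Sum>j<p ^ s. A (j + m * p ^ s) / A j * dsum a K 0 j)) / A m = (\<Sum>j<p ^ s. Aint (K - int j) * ?c j)"
    by (simp add: dsum_def sum_divide_distrib flip: sum_subtractf)
  also have "\<dots> \<in> pid (int (Suc s))"
    using assms by (intro pid_sum pid_mult0 Aint_integral A_cong) auto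
  finally show ?thesis .
qed

text \<open>Blocks of length \<open>p^t\<close> are merged into blocks of length
  \<open>p^(t+1)\<close>, one \<open>t\<close> at a time. At \<open>t = s\<close> a single block is
  left, so that block \<open>m\<close> for the shifted argument is compared with block
  \<open>0\<close>.\<close>

lemma dsum_shift:
  assumes "a < p" "t \<le> s"
    and IH: "\<And>t K m. t < s \<Longrightarrow> dsum a K t m / A m \<in> pid (int (Suc t))"
  shows "(dsum a (K + int (m * p ^ s)) s m -
    (\<Sum>j<p ^ (s - t). A (j + m * p ^ (s - t)) / A j * dsum a K t j)) / A m \<in> pid (int (Suc s))"
  using assms(2)
proof (induction t)
  case 0
  then show ?case using dsum_shift_0[OF assms(1)] by simp
next
  case (Suc t)
  define r where "r = s - Suc t"
  have r: "s - t = Suc r" using Suc.prems by (simp add: r_def)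
  let ?X = "\<lambda>v u. A (v + p * u + m * p ^ Suc r) / A (v + p * u) - A (u + m * p ^ r) / A u"
  have "(\<Sum>j<p ^ (s - t). A (j + m * p ^ (s - t)) / A j * dsum a K t j) =
    (\<Sum>u<p ^ r. \<Sum>v<p. A (v + p * u + m * p ^ Suc r) / A (v + p * u) * dsum a K t (v + p * u))"
    unfolding r power_Suc2 sum_blocks by (simp add: mult.commute)
  moreover have "(\<Sum>j<p ^ r. A (j + m * p ^ r) / A j * dsum a K (Suc t) j) =
    (\<Sum>u<p ^ r. \<Sum>v<p. A (u + m * p ^ r) / A u * dsum a K t (v + p * u))"
    by (simp add: dsum_Suc sum_distrib_left)
  ultimately have "((\<Sum>j<p ^ (s - t). A (j + m * p ^ (s - t)) / A j * dsum a K t j) -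
    (\<Sum>j<p ^ r. A (j + m * p ^ r) / A j * dsum a K (Suc t) j)) / A m =
    (\<Sum>u<p ^ r. \<Sum>v<p. ?X v u * dsum a K t (v + p * u) / A m)"
    by (simp add: sum_divide_distrib left_diff_distrib diff_divide_distrib flip: sum_subtractf)
  also have "\<dots> \<in> pid (int (Suc s))"
  proof (intro pid_sum)
    \<comment> \<open>The change of weight is worth \<open>r + 1\<close> powers of \<open>p\<close>
      by \<open>A_cong\<close>, the block itself \<open>t + 1\<close> by \<open>IH\<close>, and
      \<open>(r + 1) + (t + 1) = s + 1\<close>.\<close>
    fix u v assume uv: "u \<in> {..<p ^ r}" "v \<in> {..<p}"
    have "?X v u * dsum a K t (v + p * u) / A m =
      ((A (v + p * u + m * p ^ Suc r) - A (v + p * u) * A (u + m * p ^ r) / A u) / A m) *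
      (dsum a K t (v + p * u) / A (v + p * u))"
      using A_nonzero by (simp add: field_simps)
    also have "\<dots> \<in> pid (int (Suc r) + int (Suc t))"
      using uv Suc.prems by (intro pid_mult A_cong IH) auto
    finally show "?X v u * dsum a K t (v + p * u) / A m \<in> pid (int (Suc s))"
      using Suc.prems by (auto elim: pid_mono[rotated] simp: r_def)
  qed
  finally have 1: "((\<Sum>j<p ^ (s - t). A (j + m * p ^ (s - t)) / A j * dsum a K t j) -
    (\<Sum>j<p ^ r. A (j + m * p ^ r) / A j * dsum a K (Suc t) j)) / A m \<in> pid (int (Suc s))" .
  have "t \<le> s" using Suc.prems by simp
  from pid_add[OF Suc.IH[OF this] 1] show ?case
    by (simp add: r_def diff_divide_distrib)
qed

text \<open>By the shift relation it is enough to treat \<open>m = 0\<close>. For a minimal bad \<open>K\<close> all blocks \<open>m > 0\<close> are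
  fine, being shifts of smaller \<open>K\<close>; since all blocks together sum to zero by antisymmetry, so is
  the block \<open>m = 0\<close>.\<close>

theorem dwork_congruence:
  assumes "a < p"
  shows "dsum a K s m / A m \<in> pid (int (Suc s))"
proof (induction s arbitrary: K m rule: less_induct)
  case (less s)
  have shift: "dsum a (K + int (m * p ^ s)) s m / A m - dsum a K s 0 \<in> pid (int (Suc s))" for K m
    using dsum_shift[OF assms order_refl less, where K = K and m = m] A_nonzero[of m]
    by (simp add: A_0 diff_divide_distrib)
  have neg: "dsum a K s 0 \<in> pid (int (Suc s))" if "K < 0" for K
    using dsum_negative[OF assms that] by simp
  have nonneg: "dsum a (int K) s 0 \<in> pid (int (Suc s))" for K
  proof (induction K rule: less_induct)
    case (less K)
    have "dsum a (int K) s m \<in> pid (int (Suc s))" if m: "m > 0" for m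
    proof -
      define K' where "K' = int K - int (m * p ^ s)"
      have lt: "K' < int K" using m by (simp add: K'_def)
      have "dsum a K' s 0 \<in> pid (int (Suc s))"
      proof (cases "K' < 0")
        case False
        then show ?thesis using less.IH[of "nat K'"] lt by simp
      qed (rule neg)
      from pid_add[OF shift[of K' m] this]
      have "dsum a (int K) s m / A m \<in> pid (int (Suc s))" by (simp add: K'_def)
      from pid_mult0[OF A_integral[of m] this] show ?thesis
        using A_nonzero[of m] by simp
    qed
    then have pos: "(\<Sum>m\<in>{..<Suc K} - {0}. dsum a (int K) s m) \<in> pid (int (Suc s))"
      by (intro pid_sum) auto
    have "int K < int (Suc K * p ^ s)"
    proof -
      have "Suc K * 1 \<le> Suc K * p ^ s" using p_pos by (intro mult_le_mono2) (simp add: Suc_le_eq del: p_pos)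
      then show ?thesis by (simp only: of_nat_less_iff) simp
    qed
    then have "0 = (\<Sum>m<Suc K. dsum a (int K) s m)"
      using sum_dterm_all_zero[OF assms] unfolding sum_dterm by simp
    also have "\<dots> = dsum a (int K) s 0 + (\<Sum>m\<in>{..<Suc K} - {0}. dsum a (int K) s m)"
      by (subst sum.remove[of _ 0]) auto
    finally have "dsum a (int K) s 0 = - (\<Sum>m\<in>{..<Suc K} - {0}. dsum a (int K) s m)"
      by (simp add: eq_neg_iff_add_eq_0)
    then show ?case using pos pid_uminus by simp
  qed
  have "dsum a (K - int (m * p ^ s)) s 0 \<in> pid (int (Suc s))"
    using neg[of "K - int (m * p ^ s)"] nonneg[of "nat (K - int (m * p ^ s))"]
    by (cases "K - int (m * p ^ s) < 0") auto
  from pid_add[OF shift[of "K - int (m * p ^ s)" m] this] show ?case by simp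
qed

text \<open>Removing the base-\<open>p\<close> digits of \<open>j\<close> from the low end
  telescopes \<open>D j\<close> into pieces constant on blocks of length \<open>p^s\<close>. Each
  piece multiplies a \<open>dsum\<close>, whose \<open>s + 1\<close> powers of \<open>p\<close>
  outweigh the \<open>p^s\<close> in hypothesis \<open>D\<close>.\<close>

lemma dwork_weighted_sum:
  assumes "a < p" and D0: "D 0 = 0"
    and D: "\<And>s m. of_nat p ^ s * (D (m * p ^ s) - D (m div p * p ^ Suc s)) * A m / c \<in> pid w"
  shows "(\<Sum>j\<le>K. D j * dterm a (int K) j) / c \<in> pid (w + 1)"
proof -
  \<comment> \<open>Any \<open>j < p^L\<close> has lost all its digits after \<open>L\<close> steps,
    and the terms beyond \<open>K\<close> vanish.\<close>
  obtain L where L: "K < p ^ L"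
    using power_gt_expt[of p K] p_gt_1 by auto
  let ?d = "\<lambda>s m. D (m * p ^ s) - D (m div p * p ^ Suc s)"
  have tel: "D j = (\<Sum>s<L. ?d s (j div p ^ s))" if "j < p ^ L" for j
  proof -
    have "j div p ^ Suc s = j div p ^ s div p" for s
      by (simp add: power_Suc2 div_mult2_eq del: power_Suc)
    then have "(\<Sum>s<L. ?d s (j div p ^ s)) =
      (\<Sum>s<L. D (j div p ^ s * p ^ s) - D (j div p ^ Suc s * p ^ Suc s))"
      by simp
    also have "\<dots> = D (j div p ^ 0 * p ^ 0) - D (j div p ^ L * p ^ L)"
      by (rule sum_lessThan_telescope')
    finally show ?thesis using that D0 by simp
  qed
  have "(\<Sum>j\<le>K. D j * dterm a (int K) j) = (\<Sum>j<p ^ L. D j * dterm a (int K) j)"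
    using L assms(1) by (intro sum.mono_neutral_left) (auto intro!: dterm_beyond)
  also have "\<dots> = (\<Sum>j<p ^ L. \<Sum>s<L. ?d s (j div p ^ s) * dterm a (int K) j)"
    by (intro sum.cong refl) (simp add: tel sum_distrib_right)
  also have "\<dots> = (\<Sum>s<L. \<Sum>j<p ^ L. ?d s (j div p ^ s) * dterm a (int K) j)"
    by (rule sum.swap)
  also have "\<dots> = (\<Sum>s<L. \<Sum>m<p ^ (L - s). ?d s m * dsum a (int K) s m)"
  proof (rule sum.cong[OF refl])
    fix s assume "s \<in> {..<L}"
    then have "p ^ L = p ^ (L - s) * p ^ s" by (simp flip: power_add)
    then show "(\<Sum>j<p ^ L. ?d s (j div p ^ s) * dterm a (int K) j) =
        (\<Sum>m<p ^ (L - s). ?d s m * dsum a (int K) s m)"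
      by (simp add: sum_blocks dsum_def sum_distrib_left)
  qed
  finally have "(\<Sum>j\<le>K. D j * dterm a (int K) j) / c =
    (\<Sum>s<L. \<Sum>m<p ^ (L - s). ?d s m * dsum a (int K) s m / c)"
    by (simp add: sum_divide_distrib)
  also have "\<dots> \<in> pid (w + 1)"
  proof (intro pid_sum)
    fix s m
    have "(of_nat p ^ s * ?d s m * A m / c) * (dsum a (int K) s m / A m) \<in> pid (w + int (Suc s))"
      by (intro pid_mult D dwork_congruence assms(1))
    from pid_mult[OF p_powi_pid[of "- int s"] this]
    have "of_nat p powi (- int s) * ((of_nat p ^ s * ?d s m * A m / c) * (dsum a (int K) s m / A m))
       \<in> pid (w + 1)" by simp
    also have "of_nat p powi (- int s) * ((of_nat p ^ s * ?d s m * A m / c) * (dsum a (int K) s m / A m))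
       = ?d s m * dsum a (int K) s m / c"
    proof -
      have "inverse x * ((x * d * y / c) * (z / y)) = d * z / c" if "x \<noteq> 0" "y \<noteq> 0" for x d y z
        using that by (cases "c = 0") (simp_all add: field_simps)
      from this[of "of_nat p ^ s" "A m"] show ?thesis
        using A_nonzero[of m] by (simp add: power_int_minus)
    qed
    finally show "?d s m * dsum a (int K) s m / c \<in> pid (w + 1)" .
  qed
  finally show ?thesis .
qed

text \<open>Reflecting \<open>j\<close> to \<open>K - j\<close> in the part with
  \<open>D (K - j)\<close>, and replacing \<open>p D (a + p j)\<close> by \<open>D j\<close> at the
  cost \<open>E\<close>, leaves minus the weighted sum of the \<open>dterm\<close>s.\<close>

lemma dwork_convolution:
  assumes "a < p" and D0: "D 0 = 0"
    and D: "\<And>s m. of_nat p ^ s * (D (m * p ^ s) - D (m div p * p ^ Suc s)) * A m / c \<in> pid w"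
    and E: "\<And>j. A (a + p * j) * (of_nat p * D (a + p * j) - D j) / c \<in> pid (w + 1)"
  shows "(\<Sum>j\<le>K. A (a + p * j) * A (K - j) * (D (K - j) - of_nat p * D (a + p * j))) / c \<in> pid (w + 1)"
proof -
  have "(\<Sum>j\<le>K. A (a + p * j) * A (K - j) * D (K - j)) = (\<Sum>j\<le>K. A (a + p * (K - j)) * A j * D j)"
    by (rule sum.reindex_bij_witness[of _ "\<lambda>j. K - j" "\<lambda>j. K - j"]) auto
  then have "(\<Sum>j\<le>K. A (a + p * j) * A (K - j) * (D (K - j) - of_nat p * D (a + p * j))) =
    - (\<Sum>j\<le>K. D j * dterm a (int K) j) -
    (\<Sum>j\<le>K. A (K - j) * (A (a + p * j) * (of_nat p * D (a + p * j) - D j)))"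
    by (simp add: dterm_eq algebra_simps sum_subtractf sum.distrib)
  then have "(\<Sum>j\<le>K. A (a + p * j) * A (K - j) * (D (K - j) - of_nat p * D (a + p * j))) / c =
    - ((\<Sum>j\<le>K. D j * dterm a (int K) j) / c) -
    (\<Sum>j\<le>K. A (K - j) * (A (a + p * j) * (of_nat p * D (a + p * j) - D j) / c))"
    by (simp add: diff_divide_distrib sum_divide_distrib)
  also have "\<dots> \<in> pid (w + 1)"
    by (intro pid_diff pid_uminus pid_sum pid_mult0 dwork_weighted_sum assms A_integral)
  finally show ?thesis .
qed

end

subsection \<open>The coefficients and their harmonic weights\<close>

definition bcoef :: "nat \<Rightarrow> nat \<Rightarrow> rat" where
  "bcoef N m = fact (N * m) / fact m ^ N"

text \<open>For \<open>m > 0\<close> this counts the partitions of a set of \<open>N m\<close>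
  elements into \<open>N\<close> unlabelled blocks of size \<open>m\<close>.\<close>

definition redcoef :: "nat \<Rightarrow> nat \<Rightarrow> rat" where
  "redcoef N m = bcoef N m / fact N"

definition hdiff :: "nat \<Rightarrow> nat \<Rightarrow> rat" where
  "hdiff N m = harmonic (N * m) - harmonic m"

lemma harmonic_0 [simp]: "harmonic 0 = 0"
  by (simp add: harmonic_def)

lemma harmonic_Suc: "harmonic (Suc n) = harmonic n + 1 / of_nat (Suc n)"
  by (simp add: harmonic_def)

lemma harmonic_add: "harmonic (x + n) = harmonic x + (\<Sum>i=1..n. 1 / of_nat (x + i))"
  by (induction n) (simp_all add: harmonic_Suc)

lemma hdiff_0 [simp]: "hdiff N 0 = 0"
  by (simp add: hdiff_def)

lemma hdiff_Suc:
  "hdiff N (Suc l) = hdiff N l + ((\<Sum>i=1..N. 1 / of_nat (N * l + i)) - 1 / of_nat (Suc l))"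
  using harmonic_add[of "N * l" N] by (simp add: hdiff_def harmonic_Suc add.commute)

lemma fact_add: "fact (x + n) = (fact x * (\<Prod>i=1..n. of_nat (x + i)) :: rat)"
  by (induction n) (simp_all add: mult_ac)

lemma bcoef_0 [simp]: "bcoef N 0 = 1"
  by (simp add: bcoef_def)

lemma bcoef_nonzero [simp]: "bcoef N m \<noteq> 0"
  by (simp add: bcoef_def)

lemma redcoef_1 [simp]: "redcoef N (Suc 0) = 1"
  by (simp add: redcoef_def bcoef_def)

lemma redcoef_Suc:
  "redcoef N (Suc l) = redcoef N l * (\<Prod>i=1..N. of_nat (N * l + i)) / of_nat (Suc l) ^ N"
  using fact_add[of "N * l" N]
  by (simp add: redcoef_def bcoef_def power_mult_distrib add.commute mult.commute del: of_nat_Suc)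

text \<open>The block of a marked element can be chosen in
  \<open>((N + 1) m - 1) choose (m - 1)\<close> ways, and this is the quotient of the values at
  \<open>N + 1\<close> and \<open>N\<close>.\<close>

lemma redcoef_nat:
  assumes "m > 0"
  shows "redcoef N m \<in> \<nat>"
proof (induction N)
  case (Suc N)
  have m: "m = Suc (m - 1)" using assms by simp
  have a: "m * ((Suc N * m) choose m) = (Suc N * m) * ((Suc N * m - 1) choose (m - 1))"
    using binomial_absorption[of "m - 1" "Suc N * m"] m by metis
  then have "m * ((Suc N * m) choose m) = m * (Suc N * ((Suc N * m - 1) choose (m - 1)))"
    by (simp only: mult_ac)
  then have a: "(Suc N * m) choose m = Suc N * ((Suc N * m - 1) choose (m - 1))"
    using assms by (simp only: mult_cancel1) simp
  have "fact (Suc N * m) = fact m * fact (N * m) * (of_nat ((Suc N * m) choose m) :: rat)"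
    using binomial_fact_lemma[of m "Suc N * m", THEN arg_cong, of "of_nat :: nat \<Rightarrow> rat"]
    by simp
  then have F: "fact (Suc N * m) = fact m * fact (N * m) *
      (of_nat (Suc N) * of_nat ((Suc N * m - 1) choose (m - 1)) :: rat)"
    unfolding a by (simp only: of_nat_mult)
  have "redcoef (Suc N) m = fact (Suc N * m) / fact m ^ Suc N / (of_nat (Suc N) * fact N)"
    unfolding redcoef_def bcoef_def by (simp only: fact_Suc)
  also have "\<dots> = redcoef N m * of_nat ((Suc N * m - 1) choose (m - 1))"
    unfolding F redcoef_def bcoef_def by (simp del: of_nat_Suc mult_Suc)
  finally have "redcoef (Suc N) m = redcoef N m * of_nat ((Suc N * m - 1) choose (m - 1))" .
  then show ?case using Suc by simp
qed (simp add: redcoef_def bcoef_def)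

lemma bcoef_redcoef: "bcoef N m = fact N * redcoef N m"
  by (simp add: redcoef_def)

lemma bcoef_nat: "bcoef N m \<in> \<nat>"
proof (cases "m = 0")
  case False
  have "of_nat (fact N) \<in> (\<nat> :: rat set)" by (rule of_nat_in_Nats)
  then show ?thesis
    unfolding bcoef_redcoef using redcoef_nat[of m N] False by (intro Nats_mult) simp_all
qed simp

section \<open>Congruences for the multinomial coefficients\<close>

context p_adic
begin

lemma Nats_pid: "x \<in> \<nat> \<Longrightarrow> x \<in> pid 0"
  by (auto elim: Nats_cases)

lemma cong_pid:
  assumes "[x = y] (mod p ^ s)"
  shows "of_nat x - of_nat y \<in> pid (int s)"
proof -
  have "int p ^ s dvd int x - int y"
    using assms by (metis cong_iff_dvd_diff cong_int_iff of_nat_power)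
  then show ?thesis using of_int_pid_iff[of "int x - int y" s] by simp
qed

lemma p_free_fact_nonzero [simp]: "p_free_fact x \<noteq> 0"
  using not_dvd_p_free_fact[of x] by (metis dvd_0_right)

text \<open>The factors beyond \<open>q\<close> are congruent modulo \<open>q\<close> to those from
  \<open>1\<close> to \<open>x\<close>, and the same ones are omitted because \<open>p\<close>
  divides \<open>q\<close>.\<close>

lemma p_free_fact_add:
  assumes "p dvd q"
  shows "[p_free_fact (x + q) = p_free_fact x * p_free_fact q] (mod q)"
proof (induction x)
  case (Suc x)
  have d: "p dvd Suc (x + q) \<longleftrightarrow> p dvd Suc x"
    using assms dvd_add_left_iff[of p q "Suc x"] by simp
  show ?case
  proof (cases "p dvd Suc x")
    case True
    then show ?thesis using Suc d by (simp add: p_free_fact_Suc)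
  next
    case False
    have "[Suc (x + q) = Suc x] (mod q)"
      unfolding cong_def by (metis add_Suc mod_add_self2)
    with cong_mult[OF Suc this] show ?thesis
      using False d by (simp add: p_free_fact_Suc mult_ac del: mult_Suc mult_Suc_right)
  qed
qed simp

lemma p_free_fact_add_mult:
  assumes "p dvd q"
  shows "[p_free_fact (x + q * y) = p_free_fact x * p_free_fact q ^ y] (mod q)"
proof (induction y)
  case (Suc y)
  have "[p_free_fact (x + q * y + q) = p_free_fact (x + q * y) * p_free_fact q] (mod q)"
    by (rule p_free_fact_add[OF assms])
  also have "[p_free_fact (x + q * y) * p_free_fact q = p_free_fact x * p_free_fact q ^ y * p_free_fact q] (mod q)"
    using Suc by (intro cong_mult) auto
  finally show ?case by (simp add: algebra_simps)
qed simp

text \<open>What \<open>bcoef N m\<close> becomes when the multiples of \<open>p\<close> are deleted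
  from its factorials.\<close>

definition unit_part :: "nat \<Rightarrow> nat \<Rightarrow> rat" where
  "unit_part N m = of_nat (p_free_fact (N * m)) / of_nat (p_free_fact m) ^ N"

lemma unit_part_pid [simp]: "unit_part N m \<in> pid 0"
proof -
  have "unit_part N m = of_nat (p_free_fact (N * m)) * (1 / of_nat (p_free_fact m)) ^ N"
    by (simp add: unit_part_def power_divide)
  also have "\<dots> \<in> pid 0"
    by (intro pid_mult0 pid_power0 inverse_of_nat_pid not_dvd_p_free_fact) auto
  finally show ?thesis .
qed

text \<open>Modulo \<open>p^s\<close>, the shift by \<open>p^s y\<close> multiplies numerator and
  denominator by the same power of \<open>p_free_fact (p^s)\<close>.\<close>

lemma unit_part_cong:
  assumes "s > 0"
  shows "unit_part N (m + p ^ s * y) - unit_part N m \<in> pid (int s)"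
proof -
  let ?q = "p ^ s" and ?f = p_free_fact
  have pq: "p dvd ?q" using assms by simp
  let ?W = "?f ?q"
  have 1: "[?f (N * (m + ?q * y)) = ?f (N * m) * ?W ^ (N * y)] (mod ?q)"
    using p_free_fact_add_mult[OF pq, of "N * m" "N * y"] by (simp add: algebra_simps)
  have "[?f (m + ?q * y) ^ N = (?f m * ?W ^ y) ^ N] (mod ?q)"
    by (intro cong_pow p_free_fact_add_mult pq)
  also have "(?f m * ?W ^ y) ^ N = ?f m ^ N * ?W ^ (N * y)"
    by (simp add: power_mult_distrib mult.commute flip: power_mult)
  finally have 2: "[?f (m + ?q * y) ^ N = ?f m ^ N * ?W ^ (N * y)] (mod ?q)" .
  have "[?f (N * (m + ?q * y)) * ?f m ^ N = (?f (N * m) * ?W ^ (N * y)) * ?f m ^ N] (mod ?q)"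
    by (intro cong_mult 1 cong_refl)
  also have "(?f (N * m) * ?W ^ (N * y)) * ?f m ^ N = ?f (N * m) * (?f m ^ N * ?W ^ (N * y))"
    by (simp add: mult_ac)
  also have "[?f (N * m) * (?f m ^ N * ?W ^ (N * y)) = ?f (N * m) * ?f (m + ?q * y) ^ N] (mod ?q)"
    by (intro cong_mult cong_refl cong_sym[OF 2])
  finally have "of_nat (?f (N * (m + ?q * y)) * ?f m ^ N) - of_nat (?f (N * m) * ?f (m + ?q * y) ^ N) \<in> pid (int s)"
    by (rule cong_pid)
  moreover have "(1 / of_nat (?f m)) ^ N * (1 / of_nat (?f (m + ?q * y))) ^ N \<in> pid 0"
    by (intro pid_mult0 pid_power0 inverse_of_nat_pid not_dvd_p_free_fact)
  ultimately have "((1 / of_nat (?f m)) ^ N * (1 / of_nat (?f (m + ?q * y))) ^ N) *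
    (of_nat (?f (N * (m + ?q * y)) * ?f m ^ N) - of_nat (?f (N * m) * ?f (m + ?q * y) ^ N)) \<in> pid (int s)"
    by (rule pid_mult0[rotated])
  also have "((1 / of_nat (?f m)) ^ N * (1 / of_nat (?f (m + ?q * y))) ^ N) *
    (of_nat (?f (N * (m + ?q * y)) * ?f m ^ N) - of_nat (?f (N * m) * ?f (m + ?q * y) ^ N)) =
    unit_part N (m + ?q * y) - unit_part N m"
    by (simp add: unit_part_def field_simps)
  finally show ?thesis .
qed

text \<open>Strips the lowest base-\<open>p\<close> digit \<open>v\<close>. The multiples of
  \<open>p\<close> in the factorials reproduce \<open>bcoef N n\<close>, except for
  \<open>N v div p\<close> additional ones in the numerator, caused by the carry of
  \<open>N v\<close>.\<close>

lemma bcoef_step: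
  assumes "v < p"
  shows "bcoef N (v + p * n) = bcoef N n * (unit_part N (v + p * n) *
    (of_nat p ^ (N * v div p) * (\<Prod>i=1..N * v div p. of_nat (N * n + i))))"
proof -
  let ?m = "v + p * n" and ?M = "N * v div p"
  have 1: "?m div p = n" using assms by simp
  have "N * ?m = N * v + (N * n) * p" by (simp add: algebra_simps)
  then have 2: "N * ?m div p = N * n + ?M"
    using p_pos by (simp del: p_pos)
  show ?thesis
    unfolding bcoef_def unit_part_def fact_p_free_fact_rat[of "N * ?m"] fact_p_free_fact_rat[of ?m] 1 2
      fact_add[of "N * n" ?M]
    by (simp add: field_simps power_mult_distrib power_add flip: power_mult)
qed

lemma bcoef_pid [simp]: "bcoef N m \<in> pid 0"
  by (rule Nats_pid[OF bcoef_nat])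

text \<open>The digits of \<open>u\<close> are stripped one at a time, each at the cost of a
  \<open>p\<close>-integral factor.\<close>

lemma bcoef_ratio_pid:
  assumes "u < p ^ s"
  shows "bcoef N (u + m * p ^ s) / bcoef N m \<in> pid 0"
  using assms
proof (induction s arbitrary: u)
  case (Suc s)
  define v where "v = u mod p"
  define u' where "u' = u div p"
  have u: "u = v + p * u'" "v < p"
    using p_pos by (simp_all add: v_def u'_def del: p_pos)
  have u': "u' < p ^ s"
    using Suc.prems by (simp add: u'_def less_mult_imp_div_less mult.commute)
  have "u + m * p ^ Suc s = v + p * (u' + m * p ^ s)"
    by (simp add: u algebra_simps)
  then have "bcoef N (u + m * p ^ Suc s) / bcoef N m =
    (bcoef N (u' + m * p ^ s) / bcoef N m) * (unit_part N (v + p * (u' + m * p ^ s)) *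
    (of_nat p ^ (N * v div p) * (\<Prod>i=1..N * v div p. of_nat (N * (u' + m * p ^ s) + i))))"
    using bcoef_step[OF u(2)] by simp
  also have "\<dots> \<in> pid 0"
    by (rule pid_mult0[OF Suc.IH[OF u'] pid_mult0[OF unit_part_pid
          pid_mult0[OF pid_power0[OF of_nat_pid] pid_prod0[OF of_nat_pid]]]])
  finally show ?case .
qed simp

text \<open>\<open>bcoef_step\<close> reduces this to comparing unit parts and carry products at
  \<open>?n\<close> and \<open>u\<close>, which differ by \<open>m p^s\<close>.\<close>

lemma bcoef_cong:
  assumes v: "v < p" and u: "u < p ^ s"
  shows "(bcoef N (v + p * u + m * p ^ Suc s) - bcoef N (v + p * u) * bcoef N (u + m * p ^ s) / bcoef N u)
    / bcoef N m \<in> pid (int (Suc s))"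
proof -
  let ?M = "N * v div p" and ?n = "u + m * p ^ s"
  define P where "P n = (\<Prod>i=1..?M. of_nat (N * n + i) :: rat)" for n
  define U where "U n = unit_part N (v + p * n)" for n
  have e: "v + p * u + m * p ^ Suc s = v + p * ?n" by (simp add: algebra_simps)
  have P0: "P n \<in> pid 0" for n unfolding P_def by (intro pid_prod0 of_nat_pid)
  have vn: "v + p * ?n = (v + p * u) + p ^ Suc s * m" by (simp add: algebra_simps)
  have U: "U ?n - U u \<in> pid (int (Suc s))"
    unfolding U_def vn by (rule unit_part_cong) simp
  have P: "of_nat p ^ ?M * (P ?n - P u) \<in> pid (int (Suc s))"
  proof (cases "?M = 0")
    case True
    then show ?thesis by (simp add: P_def)
  next
    case False
    \<comment> \<open>The carry products agree only modulo \<open>p^s\<close>; the missing power of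
      \<open>p\<close> comes from \<open>p^?M\<close>, since \<open>?M > 0\<close> here.\<close>
    have "P ?n - P u \<in> pid (int s)"
      unfolding P_def
    proof (rule pid_prod_diff)
      fix i
      have "of_nat (N * m) * of_nat p ^ s \<in> pid (int s)"
        by (rule pid_mult0[OF of_nat_pid p_power_pid])
      then show "of_nat (N * ?n + i) - of_nat (N * u + i) \<in> pid (int s)"
        by (simp add: algebra_simps)
    qed (rule of_nat_pid)+
    then have "of_nat p ^ ?M * (P ?n - P u) \<in> pid (int ?M + int s)"
      by (rule pid_mult[OF p_power_pid])
    then show ?thesis using False by (elim pid_mono[rotated]) auto
  qed
  have "(bcoef N (v + p * u + m * p ^ Suc s) - bcoef N (v + p * u) * bcoef N ?n / bcoef N u) / bcoef N m
    = (bcoef N ?n / bcoef N m) * ((U ?n - U u) * (of_nat p ^ ?M * P ?n) + U u * (of_nat p ^ ?M * (P ?n - P u)))"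
    unfolding e bcoef_step[OF v] P_def[symmetric] U_def[symmetric]
    by (simp add: field_simps)
  also have "\<dots> \<in> pid (int (Suc s))"
  proof (rule pid_mult0[OF bcoef_ratio_pid[OF u] pid_add])
    show "(U ?n - U u) * (of_nat p ^ ?M * P ?n) \<in> pid (int (Suc s))"
      by (rule pid_mult0'[OF U pid_mult0[OF pid_power0[OF of_nat_pid] P0]])
    show "U u * (of_nat p ^ ?M * (P ?n - P u)) \<in> pid (int (Suc s))"
      by (rule pid_mult0[OF _ P]) (simp add: U_def)
  qed
  finally show ?thesis .
qed

text \<open>Both quotients by \<open>bcoef N m\<close> are \<open>p\<close>-integral, so their
  congruence survives taking \<open>k\<close>-th powers.\<close>

lemma bcoef_power_dwork: "dwork_sequence p (\<lambda>m. bcoef N m ^ k)"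
proof
  fix v u s m assume v: "v < p" and u: "u < p ^ s"
  let ?T = "bcoef N (v + p * u + m * p ^ Suc s) / bcoef N m"
  let ?T' = "bcoef N (v + p * u) * bcoef N (u + m * p ^ s) / bcoef N u / bcoef N m"
  have d: "?T - ?T' \<in> pid (int (Suc s))"
    using bcoef_cong[OF v u, of N m] by (simp add: diff_divide_distrib)
  have "v + p * u < p ^ Suc s"
  proof -
    have "v + p * u < p * Suc u" using v by simp
    also have "\<dots> \<le> p * p ^ s" using u by (intro mult_le_mono2) simp
    finally show ?thesis by simp
  qed
  then have T: "?T \<in> pid 0" by (rule bcoef_ratio_pid)
  have "?T - (?T - ?T') \<in> pid 0"
    by (intro pid_diff T pid_mono[OF _ d]) simp
  then have T': "?T' \<in> pid 0" by simp
  from pid_power_diff[OF T T' d, of k]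
  show "(bcoef N (v + p * u + m * p ^ Suc s) ^ k -
     bcoef N (v + p * u) ^ k * bcoef N (u + m * p ^ s) ^ k / bcoef N u ^ k) / bcoef N m ^ k \<in> pid (int (Suc s))"
    by (simp add: power_divide power_mult_distrib diff_divide_distrib)
qed (auto intro: pid_power0)

lemma redcoef_pid: "m > 0 \<Longrightarrow> redcoef N m \<in> pid 0"
  by (rule Nats_pid[OF redcoef_nat])

section \<open>Products of consecutive integers\<close>

lemma prod_pid_card:
  "finite I \<Longrightarrow> (\<Prod>i\<in>I. of_nat (f i)) \<in> pid (int (card {i\<in>I. p dvd f i}))"
proof (induction I rule: finite_induct)
  case (insert i I)
  have "of_nat (f i) \<in> pid (if p dvd f i then 1 else 0)"
    by (simp add: p_dvd_pid)
  from pid_mult[OF this insert.IH]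
  have m: "(\<Prod>i\<in>insert i I. of_nat (f i)) \<in>
     pid ((if p dvd f i then 1 else 0) + int (card {i\<in>I. p dvd f i}))"
    using insert.hyps by simp
  have "{j\<in>insert i I. p dvd f j} =
    (if p dvd f i then insert i {j\<in>I. p dvd f j} else {j\<in>I. p dvd f j})" by auto
  then have "int (card {j\<in>insert i I. p dvd f j}) =
     (if p dvd f i then 1 else 0) + int (card {i\<in>I. p dvd f i})"
    using insert.hyps by simp
  then show ?case using m by simp
qed simp

lemma card_multiples: "N div p \<le> card {i\<in>{1..N}. p dvd x + i}"
proof -
  \<comment> \<open>\<open>r\<close> is the first positive \<open>i\<close> with
    \<open>p dvd x + i\<close>. As \<open>r <= p\<close>, steps of length \<open>p\<close> from
    \<open>r\<close> meet \<open>N div p\<close> multiples.\<close>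
  define r where "r = p - x mod p"
  have r: "1 \<le> r" "r \<le> p" and pr: "p dvd x + r"
  proof -
    have "x mod p < p" by simp
    then show "1 \<le> r" "r \<le> p" unfolding r_def by linarith+
    have "x + r = p * (x div p) + p"
      using \<open>x mod p < p\<close> mult_div_mod_eq[of p x] unfolding r_def by linarith
    then show "p dvd x + r" by simp
  qed
  have "inj_on (\<lambda>q. r + p * q) {..<N div p}"
    by (rule inj_onI) simp
  moreover have "(\<lambda>q. r + p * q) ` {..<N div p} \<subseteq> {i\<in>{1..N}. p dvd x + i}"
  proof safe
    fix q assume "q < N div p"
    then have "p * Suc q \<le> p * (N div p)" by (intro mult_le_mono2) simp
    also have "\<dots> \<le> N" by simp
    finally show "r + p * q \<in> {1..N}" using r by simp
    show "p dvd x + (r + p * q)" using pr by (simp flip: add.assoc)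
  qed
  ultimately show ?thesis
    using card_inj_on_le[of "\<lambda>q. r + p * q" "{..<N div p}" "{i\<in>{1..N}. p dvd x + i}"] by simp
qed

lemma consecutive_prod_pid: "(\<Prod>i=1..N. of_nat (x + i)) \<in> pid (int (N div p))"
  using card_multiples[of N x] by (intro pid_mono[OF _ prod_pid_card]) auto

text \<open>Expanding gives products with one factor omitted, which costs at most one multiple of
  \<open>p\<close>.\<close>

lemma consecutive_prod_sum_pid:
  "(\<Prod>i=1..N. of_nat (x + i)) * (\<Sum>i=1..N. 1 / of_nat (x + i)) \<in> pid (int (N div p - 1))"
proof -
  have "(\<Prod>i=1..N. of_nat (x + i)) * (\<Sum>i=1..N. 1 / of_nat (x + i)) =
    (\<Sum>j=1..N. \<Prod>i\<in>{1..N} - {j}. of_nat (x + i) :: rat)"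
    unfolding sum_distrib_left
  proof (rule sum.cong[OF refl])
    fix j assume j: "j \<in> {1..N}"
    then show "(\<Prod>i=1..N. of_nat (x + i)) * (1 / of_nat (x + j)) =
       (\<Prod>i\<in>{1..N} - {j}. of_nat (x + i) :: rat)"
      by (subst prod.remove[of _ j]) auto
  qed
  also have "\<dots> \<in> pid (int (N div p - 1))"
  proof (rule pid_sum)
    fix j
    have "{i\<in>{1..N} - {j}. p dvd x + i} = {i\<in>{1..N}. p dvd x + i} - {j}" by auto
    then have "card {i\<in>{1..N}. p dvd x + i} - 1 \<le> card {i\<in>{1..N} - {j}. p dvd x + i}"
      using diff_card_le_card_Diff[of "{j}" "{i\<in>{1..N}. p dvd x + i}"] by simp
    then show "(\<Prod>i\<in>{1..N} - {j}. of_nat (x + i)) \<in> pid (int (N div p - 1))"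
      using card_multiples[of N x] by (intro pid_mono[OF _ prod_pid_card]) auto
  qed
  finally show ?thesis .
qed

text \<open>Passing from \<open>l\<close> to \<open>l + 1\<close> multiplies \<open>redcoef\<close> by a product of \<open>N\<close> consecutive integers, which
  nearly cancels the denominators of the new harmonic terms.\<close>

lemma redcoef_hdiff_pid:
  assumes w: "w \<le> int (N div p - 1)" and h: "harmonic N - 1 \<in> pid w"
    and "\<not> p dvd m"
  shows "redcoef N m * (hdiff N m - hdiff N (p * (m div p))) \<in> pid w"
  using assms(3)
proof (induction m)
  case (Suc l)
  show ?case
  proof (cases "l = 0")
    case True
    then show ?thesis using h p_gt_1 by (simp add: hdiff_def harmonic_def[of "Suc 0"])
  next
    case False
    then have "l > 0" by simp
    define q where "q = l div p"
    define P where "P = (\<Prod>i=1..N. of_nat (N * l + i) :: rat)"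
    define S where "S = (\<Sum>i=1..N. 1 / of_nat (N * l + i) :: rat)"
    define I where "I = (1 / of_nat (Suc l) :: rat)"
    have q: "Suc l div p = q"
      using Suc.prems by (simp add: q_def div_Suc mod_eq_0_iff_dvd)
    have I0: "I \<in> pid 0" unfolding I_def by (rule inverse_of_nat_pid[OF Suc.prems])
    have R: "redcoef N (Suc l) = redcoef N l * P * I ^ N"
      unfolding redcoef_Suc P_def I_def by (simp add: power_divide)
    have H: "hdiff N (Suc l) = hdiff N l + (S - I)"
      unfolding hdiff_Suc S_def I_def ..
    have P: "P \<in> pid (int (N div p))" unfolding P_def by (rule consecutive_prod_pid)
    have PS: "P * S \<in> pid (int (N div p - 1))" unfolding P_def S_def by (rule consecutive_prod_sum_pid)
    have P0: "P \<in> pid 0" by (rule pid_mono[OF _ P]) simp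
    \<comment> \<open>At a multiple \<open>l\<close> of \<open>p\<close> the difference is zero,
      which restarts the induction.\<close>
    have 1: "redcoef N l * (hdiff N l - hdiff N (p * q)) \<in> pid w"
    proof (cases "p dvd l")
      case True
      then show ?thesis by (simp add: q_def)
    qed (use Suc.IH in \<open>simp add: q_def\<close>)
    have "redcoef N (Suc l) * (hdiff N (Suc l) - hdiff N (p * q)) =
      (redcoef N l * (hdiff N l - hdiff N (p * q))) * (P * I ^ N) +
      redcoef N l * I ^ N * (P * S) - redcoef N l * I ^ N * I * P"
      unfolding R H by (simp add: algebra_simps)
    also have "\<dots> \<in> pid w"
    proof -
      have C: "redcoef N l * I ^ N \<in> pid 0"
        by (rule pid_mult0[OF redcoef_pid[OF \<open>l > 0\<close>] pid_power0[OF I0]])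
      have Pw: "P \<in> pid w" by (rule pid_mono[OF _ P]) (use w in simp)
      show ?thesis
        by (rule pid_diff[OF pid_add[OF pid_mult0'[OF 1 pid_mult0[OF P0 pid_power0[OF I0]]]
              pid_mono[OF w pid_mult0[OF C PS]]] pid_mult0[OF pid_mult0[OF C I0] Pw]])
    qed
    finally show ?thesis unfolding q .
  qed
qed simp

end

subsection \<open>Wolstenholme's congruence and the exponent of p in Omega\<close>

definition Omega_exp :: "nat \<Rightarrow> nat \<Rightarrow> int" where
  "Omega_exp p N = (if p \<le> N then min (2 + omega p N) (rat_val p (harmonic N - 1)) else 0)"

lemma harmonic_numeral: "harmonic (numeral k) = harmonic (pred_numeral k) + 1 / numeral k"
  using harmonic_Suc[of "pred_numeral k"] by (simp add: numeral_eq_Suc del: of_nat_Suc)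

lemma harmonic_1 [simp]: "harmonic (Suc 0) = 1"
  by (simp add: harmonic_def)

section \<open>Harmonic sums in blocks of length \<open>p\<close>\<close>

context p_adic
begin

definition hblock :: "nat \<Rightarrow> rat" where
  "hblock r = (\<Sum>i\<in>{0<..<p}. 1 / of_nat (p * r + i))"

lemma not_dvd_block: "i \<in> {0<..<p} \<Longrightarrow> \<not> p dvd p * r + i"
  using dvd_add_right_iff[of p "p * r" i] by (auto dest: dvd_imp_le)

lemma hblock_pid: "hblock r \<in> pid 0"
  unfolding hblock_def by (intro pid_sum inverse_of_nat_pid not_dvd_block)

lemma hblock_zero_eq: "hblock 0 = harmonic (p - 1)"
proof -
  have "{0<..<p} = {1..p - 1}" using p_gt_1 by auto
  then show ?thesis unfolding hblock_def harmonic_def by simp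
qed

lemma harmonic_p_mult: "harmonic (p * M) = harmonic M / of_nat p + (\<Sum>r<M. hblock r)"
proof (induction M)
  case (Suc M)
  have I: "{1..p} = insert p {0<..<p}" using p_gt_1 by auto
  have "(\<Sum>i=1..p. 1 / of_nat (p * M + i)) = 1 / of_nat (p * M + p) + hblock M"
    unfolding I hblock_def by (subst sum.insert) auto
  moreover have pM: "p * M + p = p * Suc M" by simp
  ultimately have "harmonic (p * Suc M) = harmonic (p * M) + (1 / of_nat (p * Suc M) + hblock M)"
    using harmonic_add[of "p * M" p] by (simp only: pM)
  also have "\<dots> = harmonic (Suc M) / of_nat p + (\<Sum>r<Suc M. hblock r)"
    unfolding Suc.IH harmonic_Suc
    by (simp add: add_divide_distrib mult.commute del: of_nat_Suc mult_Suc_right mult_Suc)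
  finally show ?case .
qed simp

lemma harmonic_div_pid: "harmonic N - harmonic (N div p) / of_nat p \<in> pid 0"
proof -
  let ?c = "N div p"
  have "harmonic N = harmonic (p * ?c) + (\<Sum>i=1..N mod p. 1 / of_nat (p * ?c + i))"
    using harmonic_add[of "p * ?c" "N mod p"] by simp
  then have "harmonic N - harmonic ?c / of_nat p =
    (\<Sum>r<?c. hblock r) + (\<Sum>i=1..N mod p. 1 / of_nat (p * ?c + i))"
    by (simp add: harmonic_p_mult)
  also have "\<dots> \<in> pid 0"
  proof (intro pid_add pid_sum hblock_pid inverse_of_nat_pid not_dvd_block)
    fix i assume i: "i \<in> {1..N mod p}"
    have "i < p" by (rule le_less_trans[OF _ mod_less_divisor[OF p_pos, of N]]) (use i in simp)
    then show "i \<in> {0<..<p}" using i by simp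
  qed
  finally show ?thesis .
qed

text \<open>Drives a descent: integrality of \<open>harmonic\<close> at \<open>N\<close> gives
  divisibility by \<open>p\<close> at \<open>N div p\<close>, hence integrality there.\<close>

lemma harmonic_div_pid_1:
  assumes "harmonic N \<in> pid 0"
  shows "harmonic (N div p) \<in> pid 1"
  using pid_diff[OF assms harmonic_div_pid[of N]] by (simp add: p_div_pid_iff)

definition hdefect :: "nat \<Rightarrow> nat \<Rightarrow> rat" where
  "hdefect N M = hdiff N (p * M) - hdiff N M / of_nat p"

lemma hdefect_eq: "hdefect N M = (\<Sum>r<N * M. hblock r) - (\<Sum>r<M. hblock r)"
  using harmonic_p_mult[of "N * M"] harmonic_p_mult[of M]
  by (simp add: hdefect_def hdiff_def diff_divide_distrib mult.left_commute)

lemma hdefect_pid_0: "hdefect N M \<in> pid 0"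
  unfolding hdefect_eq by (intro pid_diff pid_sum hblock_pid)

text \<open>Pairs \<open>i\<close> with \<open>p - i\<close>: the two denominators add up to
  \<open>(2 r + 1) p\<close>.\<close>

lemma hblock_symmetric:
  "2 * hblock r = of_nat (2 * r + 1) * of_nat p *
     (\<Sum>i\<in>{0<..<p}. 1 / (of_nat (p * r + i) * of_nat (p * r + (p - i))))"
proof -
  have "hblock r = (\<Sum>i\<in>{0<..<p}. 1 / of_nat (p * r + (p - i)))"
    unfolding hblock_def by (rule sum.reindex_bij_witness[of _ "\<lambda>i. p - i" "\<lambda>i. p - i"]) auto
  then have "2 * hblock r = (\<Sum>i\<in>{0<..<p}. 1 / of_nat (p * r + i) + 1 / of_nat (p * r + (p - i)))"
    unfolding sum.distrib by (simp add: hblock_def)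
  also have "\<dots> = (\<Sum>i\<in>{0<..<p}. of_nat (2 * r + 1) * of_nat p *
     (1 / (of_nat (p * r + i) * of_nat (p * r + (p - i)))))"
  proof (rule sum.cong[OF refl])
    fix i assume i: "i \<in> {0<..<p}"
    let ?x = "of_nat (p * r + i) :: rat" and ?y = "of_nat (p * r + (p - i)) :: rat"
    have "p * r + i + (p * r + (p - i)) = (2 * r + 1) * p"
      using i by (simp add: algebra_simps)
    then have sum: "?x + ?y = of_nat (2 * r + 1) * of_nat p"
      by (metis of_nat_add of_nat_mult)
    have nz: "?x \<noteq> 0" "?y \<noteq> 0" using i unfolding of_nat_eq_0_iff by auto
    have "1 / x + 1 / y = (x + y) * (1 / (x * y))" if "x \<noteq> 0" "y \<noteq> 0" for x y :: rat
      using that by (simp add: field_simps)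
    from this[OF nz] show "1 / ?x + 1 / ?y = of_nat (2 * r + 1) * of_nat p * (1 / (?x * ?y))"
      unfolding sum .
  qed
  finally show ?thesis by (simp only: sum_distrib_left)
qed

lemma half_pid: "odd p \<Longrightarrow> 1 / 2 \<in> pid 0"
  using inverse_of_nat_pid[of 2] prime_p primes_dvd_imp_eq[of p 2] two_is_prime_nat by auto

lemma block_product_pid:
  assumes "i \<in> {0<..<p}"
  shows "1 / (of_nat (p * r + i) * of_nat (p * r + (p - i))) \<in> pid 0"
proof -
  have "1 / of_nat (p * r + i) * (1 / of_nat (p * r + (p - i))) \<in> pid 0"
    using assms by (intro pid_mult0 inverse_of_nat_pid not_dvd_block) auto
  then show ?thesis by simp
qed

text \<open>\<open>(p r + i) (p r + p - i) = i (p - i) + r (r + 1) p^2\<close>, so the paired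
  reciprocals are independent of \<open>r\<close> modulo \<open>p^2\<close>; the pairing supplies a
  further factor \<open>p\<close>.\<close>

lemma hblock_cong:
  assumes "odd p"
  shows "hblock r - of_nat (2 * r + 1) * harmonic (p - 1) \<in> pid 3"
proof -
  let ?f = "\<lambda>r i. 1 / (of_nat (p * r + i) * of_nat (p * r + (p - i))) :: rat"
  have d: "?f r i - ?f 0 i \<in> pid 2" if i: "i \<in> {0<..<p}" for i
  proof (rule pid_inverse_diff)
    have "of_nat (p * r + i) * of_nat (p * r + (p - i)) - of_nat (p * 0 + i) * of_nat (p * 0 + (p - i))
      = of_nat (r * (r + 1)) * (of_nat p ^ 2 :: rat)"
    proof -
      have "(p * r + i) * (p * r + (p - i)) = i * (p - i) + r * (r + 1) * p ^ 2"
      proof -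
        have "(p * r + i) * (p * r + j) = i * j + r * (p * r + (i + j)) * p" if "i + j = p" for j
          by (simp only: that[symmetric]) (simp add: algebra_simps)
        from this[of "p - i"] show ?thesis
          using i by (simp add: algebra_simps power2_eq_square)
      qed
      from arg_cong[OF this, of "of_nat :: nat \<Rightarrow> rat"] show ?thesis by simp
    qed
    then show "of_nat (p * r + i) * of_nat (p * r + (p - i)) - of_nat (p * 0 + i) * of_nat (p * 0 + (p - i)) \<in> pid 2"
      using pid_mult0[OF of_nat_pid p_power_pid[of 2], of "r * (r + 1)"] by (simp only: of_nat_numeral)
    show "of_nat (p * r + i) * of_nat (p * r + (p - i)) \<noteq> (0 :: rat)"
      "of_nat (p * 0 + i) * of_nat (p * 0 + (p - i)) \<noteq> (0 :: rat)"
      using i unfolding of_nat_mult[symmetric] of_nat_eq_0_iff by auto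
  qed (rule block_product_pid[OF i])+
  have "2 * (hblock r - of_nat (2 * r + 1) * harmonic (p - 1)) =
    2 * hblock r - of_nat (2 * r + 1) * (2 * hblock 0)"
    by (simp add: hblock_zero_eq algebra_simps)
  also have "\<dots> = of_nat (2 * r + 1) * (of_nat p * (\<Sum>i\<in>{0<..<p}. ?f r i - ?f 0 i))"
    unfolding hblock_symmetric sum_subtractf by (simp add: algebra_simps)
  also have "\<dots> \<in> pid 3"
  proof (rule pid_mult0)
    show "of_nat p * (\<Sum>i\<in>{0<..<p}. ?f r i - ?f 0 i) \<in> pid 3"
      unfolding p_mult_pid_iff using d by (intro pid_sum) simp
  qed (rule of_nat_pid)
  finally have "1 / 2 * (2 * (hblock r - of_nat (2 * r + 1) * harmonic (p - 1))) \<in> pid 3"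
    by (rule pid_mult0[OF half_pid[OF assms]])
  moreover have "1 / 2 * (2 * x) = x" for x :: rat by simp
  ultimately show ?thesis by (simp only:)
qed

section \<open>Wolstenholme's theorem and the harmonic defect\<close>

lemma harmonic_pred_pid_1:
  assumes "odd p"
  shows "harmonic (p - 1) \<in> pid 1"
proof -
  have "(\<Sum>i\<in>{0<..<p}. 1 / (of_nat (p * 0 + i) * of_nat (p * 0 + (p - i)))) \<in> pid (1 - 1)"
    unfolding diff_self by (intro pid_sum block_product_pid)
  then have "2 * hblock 0 \<in> pid 1"
    unfolding hblock_symmetric mult.assoc p_mult_pid_iff[symmetric] by (rule pid_mult0[OF of_nat_pid])
  from pid_mult0[OF half_pid[OF assms] this] show ?thesis by (simp add: hblock_zero_eq)
qed

text \<open>Doubling permutes the nonzero residues, so the sum \<open>S\<close> is congruent to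
  \<open>S / 4\<close>; then \<open>p\<close> divides \<open>3 S / 4\<close>, where \<open>3\<close>
  is a unit as \<open>p > 3\<close>.\<close>

lemma sum_inverse_squares_pid:
  assumes "p > 3"
  shows "(\<Sum>i\<in>{0<..<p}. 1 / of_nat i ^ 2) \<in> pid 1"
proof -
  define S where "S = (\<Sum>i\<in>{0<..<p}. 1 / of_nat i ^ 2 :: rat)"
  have nd: "\<not> p dvd i" if "i \<in> {0<..<p}" for i
    using not_dvd_block[OF that, of 0] by simp
  have p2: "\<not> p dvd 2" and p3: "\<not> p dvd 3" using assms by (auto dest: dvd_imp_le)
  have ndm: "\<not> p dvd 2 * i" if "i \<in> {0<..<p}" for i
    using nd[OF that] p2 prime_p prime_dvd_mult_iff by blast
  have inv: "1 / of_nat j ^ 2 \<in> pid 0" if "\<not> p dvd j" for j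
    using pid_power0[OF inverse_of_nat_pid[OF that], of 2] by (simp add: power_divide)
  let ?\<sigma> = "\<lambda>i. 2 * i mod p"
  have maps: "?\<sigma> ` {0<..<p} \<subseteq> {0<..<p}"
    using ndm p_gt_1 by (auto simp: mod_greater_zero_iff_not_dvd)
  have inj: "inj_on ?\<sigma> {0<..<p}"
  proof (rule inj_onI)
    fix i j assume i: "i \<in> {0<..<p}" and j: "j \<in> {0<..<p}" and eq: "?\<sigma> i = ?\<sigma> j"
    have "coprime 2 p" using prime_p p2 by (metis coprime_commute prime_imp_coprime)
    then have "[i = j] (mod p)"
      using eq by (simp add: cong_def[symmetric] cong_mult_lcancel_nat)
    then show "i = j" using i j by (simp add: cong_def)
  qed
  have "S = (\<Sum>i\<in>{0<..<p}. 1 / of_nat (?\<sigma> i) ^ 2)"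
    unfolding S_def using endo_inj_surj[OF _ maps inj] sum.reindex[OF inj, of "\<lambda>i. 1 / of_nat i ^ 2 :: rat"]
    by simp
  also have "\<dots> - 1 / 4 * S = (\<Sum>i\<in>{0<..<p}. 1 / of_nat (?\<sigma> i) ^ 2 - 1 / of_nat (2 * i) ^ 2)"
    unfolding S_def sum_subtractf by (simp add: sum_distrib_left power_mult_distrib)
  also have "\<dots> \<in> pid 1"
  proof (rule pid_sum)
    fix i assume i: "i \<in> {0<..<p}"
    show "1 / of_nat (?\<sigma> i) ^ 2 - 1 / of_nat (2 * i) ^ 2 \<in> pid 1"
    proof (rule pid_inverse_diff)
      have "[?\<sigma> i = 2 * i] (mod p ^ 1)" by (simp add: cong_def)
      then have "of_nat (?\<sigma> i) - of_nat (2 * i) \<in> pid (int 1)" by (rule cong_pid)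
      then show "of_nat (?\<sigma> i) ^ 2 - of_nat (2 * i) ^ 2 \<in> pid 1"
        by (intro pid_power_diff of_nat_pid) simp
      have "?\<sigma> i \<in> {0<..<p}" using maps i by blast
      then show "1 / of_nat (?\<sigma> i) ^ 2 \<in> pid 0" "of_nat (?\<sigma> i) ^ 2 \<noteq> (0 :: rat)"
        using inv[OF nd] by auto
      show "1 / of_nat (2 * i) ^ 2 \<in> pid 0" by (rule inv[OF ndm[OF i]])
      show "of_nat (2 * i) ^ 2 \<noteq> (0 :: rat)" using i by simp
    qed
  qed
  finally have "3 * S / 4 \<in> pid 1" by simp
  from pid_mult0[OF of_nat_pid[of 4] pid_mult0[OF inverse_of_nat_pid[OF p3] this]]
  show ?thesis by (simp add: S_def)
qed

text \<open>Beyond the factor \<open>p\<close> from the pairing, \<open>p - i\<close> is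
  \<open>- i\<close> modulo \<open>p\<close>, which turns the paired sum into minus the sum of
  inverse squares.\<close>

lemma wolstenholme:
  assumes "p > 3"
  shows "harmonic (p - 1) \<in> pid 2"
proof -
  have odd: "odd p" using assms prime_p primes_dvd_imp_eq[of 2 p] two_is_prime_nat by auto
  let ?f = "\<lambda>i. 1 / (of_nat i * of_nat (p - i)) :: rat"
  have "?f i + 1 / of_nat i ^ 2 \<in> pid 1" if i: "i \<in> {0<..<p}" for i
  proof -
    have nz: "(of_nat i :: rat) \<noteq> 0" "of_nat (p - i) \<noteq> (0 :: rat)" using i by auto
    have s: "of_nat i + of_nat (p - i) = (of_nat p :: rat)"
      using i by (simp flip: of_nat_add)
    have "1 / (x * y) + 1 / x ^ 2 = 1 / x * (1 / (x * y)) * (x + y)" if "x \<noteq> 0" "y \<noteq> 0" for x y :: rat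
      using that by (simp add: field_simps power2_eq_square)
    from this[OF nz] have "?f i + 1 / of_nat i ^ 2 = 1 / of_nat i * ?f i * of_nat p"
      unfolding s .
    also have "\<dots> \<in> pid 1"
      using block_product_pid[OF i, of 0] not_dvd_block[OF i, of 0]
      by (intro pid_mult0[OF _ p_pid] pid_mult0 inverse_of_nat_pid) simp_all
    finally show ?thesis .
  qed
  then have "(\<Sum>i\<in>{0<..<p}. ?f i + 1 / of_nat i ^ 2) \<in> pid 1"
    by (rule pid_sum)
  from pid_diff[OF this sum_inverse_squares_pid[OF assms]]
  have "(\<Sum>i\<in>{0<..<p}. ?f i) \<in> pid 1" by (simp add: sum.distrib)
  then have "of_nat p * (\<Sum>i\<in>{0<..<p}. ?f i) \<in> pid 2" by (simp add: p_mult_pid_iff)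
  then have "2 * hblock 0 \<in> pid 2"
    unfolding hblock_symmetric by simp
  from pid_mult0[OF half_pid[OF odd] this] show ?thesis by (simp add: hblock_zero_eq)
qed

text \<open>The weights \<open>2 r + 1\<close> in \<open>hblock_cong\<close> are the odd numbers,
  whose sum over \<open>r < M\<close> is \<open>M^2\<close>.\<close>

lemma sum_hblock_cong:
  assumes "odd p"
  shows "(\<Sum>r<M. hblock r) - of_nat (M ^ 2) * harmonic (p - 1) \<in> pid 3"
proof (induction M)
  case (Suc M)
  have eq: "(\<Sum>r<Suc M. hblock r) - of_nat (Suc M ^ 2) * harmonic (p - 1) =
    ((\<Sum>r<M. hblock r) - of_nat (M ^ 2) * harmonic (p - 1)) +
    (hblock M - of_nat (2 * M + 1) * harmonic (p - 1))"
    by (simp add: algebra_simps power2_eq_square)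
  show ?case unfolding eq by (rule pid_add[OF Suc hblock_cong[OF assms]])
qed simp

lemma hdefect_cong:
  assumes "odd p"
  shows "hdefect N M - of_int ((int N ^ 2 - 1) * int M ^ 2) * harmonic (p - 1) \<in> pid 3"
proof -
  have "hdefect N M - of_int ((int N ^ 2 - 1) * int M ^ 2) * harmonic (p - 1) =
    ((\<Sum>r<N * M. hblock r) - of_nat ((N * M) ^ 2) * harmonic (p - 1)) -
    ((\<Sum>r<M. hblock r) - of_nat (M ^ 2) * harmonic (p - 1))"
    unfolding hdefect_eq by (simp add: algebra_simps power_mult_distrib)
  then show ?thesis
    using pid_diff[OF sum_hblock_cong[OF assms] sum_hblock_cong[OF assms]] by presburger
qed

lemma hdefect_pid:
  assumes "odd p" "e \<le> 3" "of_int ((int N ^ 2 - 1) * int M ^ 2) * harmonic (p - 1) \<in> pid e"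
  shows "hdefect N M \<in> pid e"
  using pid_add[OF pid_mono[OF assms(2) hdefect_cong[OF assms(1), of N M]] assms(3)] by simp

section \<open>Bounds on the exponent of \<open>p\<close> in \<open>Omega\<close>\<close>

lemma numerator_pid: "x / y \<in> pid e \<Longrightarrow> y \<in> pid 0 \<Longrightarrow> y \<noteq> 0 \<Longrightarrow> x \<in> pid e"
  using pid_mult0'[of "x / y" e y] by simp

text \<open>Multiplying by the integer denominator preserves membership, so the numerator decides.
  Phrased with numerals to fit harmonic numbers evaluated by the simplifier.\<close>

lemma fraction_not_pid:
  assumes "int p ^ e = numeral q" "\<not> numeral q dvd (numeral a :: int)"
  shows "numeral a / numeral b \<notin> pid (int e)"
proof
  assume "numeral a / numeral b \<in> pid (int e)"
  from numerator_pid[OF this] have "of_int (numeral a) \<in> pid (int e)" by simp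
  then show False using assms by (simp only: of_int_pid_iff)
qed

text \<open>For \<open>p > N\<close> the exponent is \<open>0\<close>, and
  \<open>N div p = 0\<close> makes \<open>harmonic N\<close> integral.\<close>

lemma Omega_exp_pid: "harmonic N - 1 \<in> pid (Omega_exp p N)"
proof (cases "p \<le> N")
  case True
  then show ?thesis by (auto simp: Omega_exp_def intro: rat_val_pid)
next
  case False
  then have "harmonic N \<in> pid 0" using harmonic_div_pid[of N] by simp
  then show ?thesis using False by (simp add: Omega_exp_def pid_diff)
qed

lemma Omega_exp_ge_0_D:
  assumes "Omega_exp p N \<ge> 0"
  shows "harmonic (N div p) \<in> pid 1"
proof (rule harmonic_div_pid_1)
  have "harmonic N - 1 + 1 \<in> pid 0"
    by (rule pid_add[OF pid_mono[OF assms Omega_exp_pid]]) simp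
  then show "harmonic N \<in> pid 0" by simp
qed

lemma Omega_exp_eq_0: "\<not> p \<le> N \<Longrightarrow> Omega_exp p N = 0"
  by (simp add: Omega_exp_def)

lemma omega_le_1: "omega p N \<le> 1"
  by (simp add: omega_def)

lemma Omega_exp_le: "Omega_exp p N \<le> 2 + omega p N"
  by (auto simp: Omega_exp_def omega_def)

lemma one_not_pid: "1 \<notin> pid 1"
  using of_int_pid_iff[of 1 1] p_gt_1 by auto

text \<open>The descent along \<open>N div 2\<close> ends at \<open>harmonic 1 = 1\<close>.\<close>

lemma harmonic_2_adic:
  assumes "p = 2" "N > 0"
  shows "harmonic N \<notin> pid 1"
  using assms(2)
proof (induction N rule: less_induct)
  case (less N)
  show ?case
  proof (cases "N = 1")
    case True
    then show ?thesis using one_not_pid by (simp add: harmonic_def)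
  next
    case False
    then have "N div 2 > 0" "N div 2 < N" using less.prems by auto
    then have "harmonic (N div p) \<notin> pid 1" using less.IH assms(1) by simp
    then show ?thesis using harmonic_div_pid_1 pid_mono[of 0 1 "harmonic N"] by auto
  qed
qed

text \<open>The prime 3 is exceptional: \<open>v_3(H_66 - 1) = v_3(H_68 - 1) = 1\<close>, while the Wolstenholme-type
  estimate is weaker by one power.\<close>

lemma harmonic_3_adic:
  assumes "p = 3" "harmonic N \<in> pid 1"
  shows "N \<in> {0, 2, 7, 22}"
  using assms(2)
proof (induction N rule: less_induct)
  case (less N)
  have frac: "numeral a / numeral b \<notin> pid 1" if "\<not> 3 dvd (numeral a :: int)" for a b
    using fraction_not_pid[of 1 "num.Bit1 num.One" a b] that assms(1) by simp
  \<comment> \<open>Besides \<open>0\<close>, \<open>2\<close>, \<open>7\<close>, \<open>22\<close>,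
    the descent admits only \<open>1\<close> and the numbers \<open>3 c + d\<close> with
    \<open>c\<close> one of \<open>2\<close>, \<open>7\<close>, \<open>22\<close> and
    \<open>d < 3\<close>; this list excludes them.\<close>
  have "\<forall>M\<in>{1, 6, 8, 21, 23, 66, 67, 68}. harmonic M \<notin> pid 1"
    using one_not_pid by (simp add: harmonic_numeral frac)
  then have c: "N \<notin> {1, 6, 8, 21, 23, 66, 67, 68}"
    using less.prems by blast
  show ?case
  proof (cases "N < 3")
    case True
    then show ?thesis using c by auto
  next
    case False
    have "harmonic (N div p) \<in> pid 1"
      using less.prems pid_mono[of 0 1] by (intro harmonic_div_pid_1) auto
    then have "N div 3 \<in> {0, 2, 7, 22}"
      using less.IH[of "N div 3"] False assms(1) by auto
    moreover have "N = 3 * (N div 3) + N mod 3" "N mod 3 < 3" by auto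
    ultimately have "N \<in> {6, 7, 8, 21, 22, 23, 66, 67, 68}"
      using False by auto
    then show ?thesis using c by auto
  qed
qed

lemma Omega_exp_2_adic:
  assumes "p = 2"
  shows "Omega_exp p N \<le> 0"
proof (cases "p \<le> N")
  case True
  then have "N div p > 0" by (simp add: div_greater_zero_iff)
  then show ?thesis
    using harmonic_2_adic[OF assms] Omega_exp_ge_0_D[of N] by fastforce
qed (simp add: Omega_exp_eq_0)

text \<open>By \<open>harmonic_3_adic\<close> a positive exponent leaves nine candidates for
  \<open>N\<close>, and \<open>9\<close> divides \<open>harmonic N - 1\<close> for none of
  them.\<close>

lemma Omega_exp_3_adic:
  assumes "p = 3"
  shows "Omega_exp p N \<le> 1 \<and> (Omega_exp p N \<le> 0 \<or> N div p \<ge> 2)"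
proof (cases "Omega_exp p N \<le> 0")
  case False
  then have "p \<le> N" using Omega_exp_eq_0 by fastforce
  have "N div 3 \<in> {0, 2, 7, 22}"
    using harmonic_3_adic[OF assms] Omega_exp_ge_0_D[of N] False assms by auto
  then have c: "N div 3 \<in> {2, 7, 22}" using \<open>p \<le> N\<close> assms by auto
  moreover have "N = 3 * (N div 3) + N mod 3" "N mod 3 < 3" by auto
  ultimately have N: "N \<in> {6, 7, 8, 21, 22, 23, 66, 67, 68}" by auto
  have frac: "numeral a / numeral b \<notin> pid 2" if "\<not> 9 dvd (numeral a :: int)" for a b
    using fraction_not_pid[of 2 "num.Bit1 (num.Bit0 (num.Bit0 num.One))" a b] that assms by simp
  have "\<forall>M\<in>{6, 7, 8, 21, 22, 23, 66, 67, 68}. harmonic M - 1 \<notin> pid 2"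
    by (simp add: harmonic_numeral frac)
  then have "harmonic N - 1 \<notin> pid 2" using N by blast
  then have "Omega_exp p N \<le> 1"
    using pid_mono[OF _ Omega_exp_pid[of N], of 2] by force
  then show ?thesis using c assms by auto
qed simp

text \<open>The exponent is at most \<open>3\<close>, so for \<open>p > 3\<close> only
  \<open>N div p <= 3\<close> is in doubt. A positive exponent makes \<open>p\<close> divide one of
  \<open>1\<close>, \<open>3/2\<close>, \<open>11/6\<close>; this leaves \<open>p = 11\<close> with
  \<open>N\<close> from \<open>33\<close> to \<open>43\<close>, which are checked directly.\<close>

lemma Omega_exp_le_div: "Omega_exp p N \<le> int (N div p - 1)"
proof (cases "Omega_exp p N \<le> 0")
  case False
  then have "p \<le> N" using Omega_exp_eq_0 by fastforce
  then have c1: "N div p \<ge> 1" by (simp add: div_greater_zero_iff Suc_le_eq)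
  have h: "harmonic (N div p) \<in> pid 1" using Omega_exp_ge_0_D False by simp
  have w3: "Omega_exp p N \<le> 3" using Omega_exp_le[of N] omega_le_1[of N] by linarith
  consider "p = 2" | "p = 3" | "p > 3" using p_gt_1 by linarith
  then show ?thesis
  proof cases
    case 3
    have frac: "int p dvd numeral a" if "numeral a / numeral b \<in> pid 1" for a b
      using numerator_pid[OF that] of_int_pid_iff[of "numeral a" 1] by simp
    have "\<not> int p dvd 3" using 3 by (auto dest: zdvd_imp_le)
    then have "harmonic 1 \<notin> pid 1" "harmonic 2 \<notin> pid 1"
      using one_not_pid frac[of "num.Bit1 num.One" "num.Bit0 num.One"] by (auto simp: harmonic_numeral)
    then have "N div p \<noteq> 1" "N div p \<noteq> 2" using h by auto
    moreover have "N div p \<noteq> 3"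
    proof
      assume c: "N div p = 3"
      then have "11 / 6 \<in> pid 1" using h by (simp add: harmonic_numeral)
      then have "int p dvd int 11" using frac by fastforce
      then have "p dvd 11" by (simp only: int_dvd_int_iff)
      moreover have "prime (11 :: nat)" by simp
      ultimately have p: "p = 11" using prime_p primes_dvd_imp_eq by blast
      moreover have "N = 11 * (N div 11) + N mod 11" "N mod 11 < 11" by auto
      ultimately have "N \<in> {33..<44}" using c by auto
      then have N: "N \<in> set [33..<44]" by (simp only: set_upt)
      have frac: "numeral a / numeral b \<notin> pid 1" if "\<not> 11 dvd (numeral a :: int)" for a b
        using frac[of a b] that p by auto
      have "\<forall>M\<in>set [33..<44]. harmonic M - 1 \<notin> pid 1"
        by (simp add: harmonic_numeral frac)
      then have "harmonic N - 1 \<notin> pid 1" using N by blast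
      then show False using pid_mono[OF _ Omega_exp_pid[of N], of 1] False by force
    qed
    ultimately have "N div p \<ge> 4" using c1 by linarith
    then show ?thesis using w3 by linarith
  qed (use Omega_exp_2_adic[of N] Omega_exp_3_adic[of N] False in auto)
qed simp

text \<open>For \<open>p > 3\<close> Wolstenholme gives \<open>2\<close>, and \<open>omega\<close>
  adds \<open>1\<close> when \<open>harmonic (p - 1)\<close> lies in \<open>pid 3\<close> or when
  \<open>p\<close> divides \<open>N^2 - 1\<close>. For \<open>p = 3\<close> the factor
  \<open>harmonic 2\<close> gives just \<open>1\<close>, matching the bound on the exponent.\<close>

lemma hdefect_Omega_exp: "hdefect N M \<in> pid (Omega_exp p N)"
proof (cases "Omega_exp p N \<le> 0")
  case True
  then show ?thesis by (rule pid_mono[OF _ hdefect_pid_0])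
next
  case False
  have "p \<noteq> 2" using Omega_exp_2_adic[of N] False by auto
  then have odd: "odd p" using prime_p primes_dvd_imp_eq[of 2 p] two_is_prime_nat by auto
  show ?thesis
  proof (cases "p = 3")
    case True
    have "hdefect N M \<in> pid 1"
      by (rule hdefect_pid[OF odd _ pid_mult0[OF of_int_pid harmonic_pred_pid_1[OF odd]]]) simp
    then show ?thesis by (rule pid_mono[rotated]) (use Omega_exp_3_adic[OF True, of N] in simp)
  next
    case False
    then have p3: "p > 3" using p_gt_1 \<open>p \<noteq> 2\<close> by linarith
    note H = wolstenholme[OF p3]
    have "of_int ((int N ^ 2 - 1) * int M ^ 2) * harmonic (p - 1) \<in> pid (2 + omega p N)"
    proof (cases "omega p N = 1")
      case om: True
      show ?thesis
      proof (cases "wolstenholme_prime p")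
        case True
        then have "harmonic (p - 1) \<in> pid 3"
          by (intro rat_val_pid) (simp add: wolstenholme_prime_def)
        from pid_mult0[OF of_int_pid this] show ?thesis using om by (simp del: of_int_mult)
      next
        case False
        then have "[int N = 1] (mod int p) \<or> [int N = - 1] (mod int p)"
          using om by (auto simp: omega_def split: if_splits)
        then have "int p dvd int N - 1 \<or> int p dvd int N + 1"
          by (auto simp: cong_iff_dvd_diff)
        then have "int p dvd (int N - 1) * (int N + 1)" by auto
        moreover have "(int N - 1) * (int N + 1) = int N ^ 2 - 1"
          by (simp add: algebra_simps power2_eq_square)
        ultimately have "int p dvd (int N ^ 2 - 1) * int M ^ 2" by auto
        then have "of_int ((int N ^ 2 - 1) * int M ^ 2) \<in> pid 1"
          using of_int_pid_iff[of _ 1] by (simp del: of_int_mult)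
        from pid_mult[OF this H] show ?thesis using om by (simp del: of_int_mult)
      qed
    next
      case False
      then have "omega p N = 0" by (auto simp: omega_def)
      then show ?thesis using pid_mult0[OF of_int_pid H] by (simp del: of_int_mult)
    qed
    then have "hdefect N M \<in> pid (2 + omega p N)"
      using omega_le_1[of N] by (intro hdefect_pid[OF odd]) auto
    then show ?thesis by (rule pid_mono[OF Omega_exp_le])
  qed
qed

end

subsection \<open>Integrality of the mirror map\<close>

text \<open>\<open>1 / (j / N + n) = N / (N n + j)\<close>. Adding and subtracting the term
  \<open>j = N\<close>, which is \<open>shifted_harmonic 1 m\<close>, completes the harmonic number
  of \<open>N m\<close>.\<close>

lemma sum_shifted_harmonic:
  assumes "N > 0"
  shows "(\<Sum>j=1..N-1. shifted_harmonic (of_nat j / of_nat N) m) - of_nat (N - 1) * shifted_harmonic 1 m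
    = of_nat N * hdiff N m"
proof (induction m)
  case (Suc m)
  have N: "(of_nat N :: rat) \<noteq> 0" using assms by simp
  have I: "{1..N} = insert N {1..N-1}" using assms by auto
  have "N \<notin> {1..N-1}" using assms by auto
  then have "(\<Sum>i=1..N. 1 / of_nat (N * m + i)) =
      1 / of_nat (N * Suc m) + (\<Sum>i=1..N-1. 1 / of_nat (N * m + i) :: rat)"
    unfolding I by (subst sum.insert) (auto simp: add.commute)
  then have "of_nat N * (\<Sum>i=1..N. 1 / of_nat (N * m + i)) =
      1 / of_nat (Suc m) + of_nat N * (\<Sum>i=1..N-1. 1 / of_nat (N * m + i) :: rat)"
    using N by (simp add: distrib_left del: of_nat_Suc mult_Suc_right)
  also have "of_nat N * (\<Sum>i=1..N-1. 1 / of_nat (N * m + i) :: rat) =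
     (\<Sum>j=1..N-1. 1 / (of_nat j / of_nat N + of_nat m))"
    unfolding sum_distrib_left using N by (intro sum.cong refl) (simp add: field_simps)
  finally have eq: "of_nat N * (\<Sum>i=1..N. 1 / of_nat (N * m + i)) =
    1 / of_nat (Suc m) + (\<Sum>j=1..N-1. 1 / (of_nat j / of_nat N + of_nat m) :: rat)" .
  have "n * (h + (S - r)) = n * h + T - (n - 1) * r" if "n * S = r + T" for n h S r T :: rat
    using that by (simp add: algebra_simps)
  from this[OF eq] have "of_nat N * hdiff N (Suc m) = of_nat N * hdiff N m +
    (\<Sum>j=1..N-1. 1 / (of_nat j / of_nat N + of_nat m)) - (of_nat N - 1) * (1 / of_nat (Suc m))"
    unfolding hdiff_Suc .
  also have "of_nat N - 1 = (of_nat (N - 1) :: rat)" using assms by (simp add: of_nat_diff)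
  finally show ?case
    unfolding Suc.IH[symmetric] by (simp add: shifted_harmonic_def sum.distrib algebra_simps)
qed (simp add: shifted_harmonic_def)

lemma F_ser_bcoef: "F_ser N k = Abs_fps (\<lambda>m. bcoef N m ^ k)"
  unfolding F_ser_def bcoef_def by (simp add: power_divide mult.commute flip: power_mult)

lemma G_ser_bcoef:
  assumes "N > 0"
  shows "G_ser N k = fps_const (of_nat k * of_nat N) * Abs_fps (\<lambda>m. bcoef N m ^ k * hdiff N m)"
proof (rule fps_ext)
  fix m
  have "fact (N * m) ^ k / fact m ^ (k * N) = bcoef N m ^ k"
    unfolding bcoef_def by (simp add: power_divide mult.commute flip: power_mult)
  then show "G_ser N k $ m = (fps_const (of_nat k * of_nat N) * Abs_fps (\<lambda>m. bcoef N m ^ k * hdiff N m)) $ m"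
    unfolding G_ser_def sum_shifted_harmonic[OF assms] by simp
qed

section \<open>The two hypotheses of \<open>dwork_convolution\<close>\<close>

context p_adic
begin

text \<open>The difference telescopes into multiples of the defects at \<open>x\<close>,
  \<open>p x\<close>, and so on.\<close>

lemma hdiff_p_power:
  "of_nat p ^ s * hdiff N (x * p ^ s) - hdiff N x \<in> pid (Omega_exp p N)"
proof (induction s)
  case (Suc s)
  have E: "hdiff N (x * p ^ Suc s) = hdiff N (x * p ^ s) / of_nat p + hdefect N (x * p ^ s)"
    by (simp add: hdefect_def mult.left_commute)
  have "of_nat p ^ Suc s * hdiff N (x * p ^ Suc s) - hdiff N x =
     (of_nat p ^ s * hdiff N (x * p ^ s) - hdiff N x) + of_nat p ^ Suc s * hdefect N (x * p ^ s)"
    unfolding E by (simp add: field_simps)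
  then show ?case
    using pid_add[OF Suc pid_mult0[OF pid_power0[OF of_nat_pid] hdefect_Omega_exp]] by presburger
qed simp

text \<open>One of the \<open>k\<close> factors \<open>redcoef N m\<close> absorbs the denominator
  of \<open>x\<close>; the others are integers.\<close>

lemma bcoef_power_mult_pid:
  assumes "k > 0" "m > 0" "redcoef N m * x \<in> pid e"
  shows "bcoef N m ^ k * x / fact N ^ k \<in> pid e"
proof -
  obtain l where k: "k = Suc l" using assms(1) by (cases k) auto
  have "bcoef N m ^ k * x / fact N ^ k = redcoef N m ^ l * (redcoef N m * x)"
    unfolding redcoef_def k by (simp add: power_divide mult_ac)
  then show ?thesis
    using pid_mult0[OF pid_power0[OF redcoef_pid[OF assms(2)]] assms(3)] by simp
qed

text \<open>If \<open>p\<close> divides \<open>m\<close> the difference is zero. Otherwise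
  \<open>hdiff_p_power\<close> brings it down to level \<open>s = 0\<close>, where
  \<open>redcoef_hdiff_pid\<close> applies.\<close>

lemma hdiff_levels_pid:
  assumes "k > 0"
  shows "of_nat p ^ s * (hdiff N (m * p ^ s) - hdiff N (m div p * p ^ Suc s)) * bcoef N m ^ k / fact N ^ k
    \<in> pid (Omega_exp p N)"
proof (cases "p dvd m")
  case True
  then have e: "m div p * p ^ Suc s = m * p ^ s" by auto
  show ?thesis unfolding e by simp
next
  case False
  then have "m > 0" by (auto intro: Nat.gr0I)
  let ?y = "p * (m div p)"
  have e: "m div p * p ^ Suc s = ?y * p ^ s" by simp
  let ?d = "\<lambda>x. of_nat p ^ s * hdiff N (x * p ^ s) - hdiff N x"
  have "redcoef N m * (of_nat p ^ s * (hdiff N (m * p ^ s) - hdiff N (?y * p ^ s))) =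
    redcoef N m * (hdiff N m - hdiff N ?y) + redcoef N m * (?d m - ?d ?y)"
    by (simp add: algebra_simps)
  also have "\<dots> \<in> pid (Omega_exp p N)"
    using False \<open>m > 0\<close>
    by (intro pid_add redcoef_hdiff_pid Omega_exp_le_div Omega_exp_pid
        pid_mult0[OF redcoef_pid pid_diff] hdiff_p_power)
  finally have "bcoef N m ^ k * (of_nat p ^ s * (hdiff N (m * p ^ s) - hdiff N (?y * p ^ s))) / fact N ^ k
      \<in> pid (Omega_exp p N)"
    by (rule bcoef_power_mult_pid[OF assms \<open>m > 0\<close>])
  then show ?thesis unfolding e by (simp only: mult_ac)
qed

lemma hdiff_residue_pid:
  assumes "k > 0" "a < p"
  shows "bcoef N (a + p * j) ^ k * (of_nat p * hdiff N (a + p * j) - hdiff N j) / fact N ^ k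
    \<in> pid (Omega_exp p N + 1)"
proof (cases "a + p * j = 0")
  case True
  then show ?thesis by simp
next
  case False
  let ?m = "a + p * j"
  have m: "?m > 0" using False by simp
  have div: "?m div p = j" using assms(2) by simp
  have 1: "redcoef N ?m * (hdiff N ?m - hdiff N (p * j)) \<in> pid (Omega_exp p N)"
  proof (cases "a = 0")
    case False
    then have "\<not> p dvd ?m"
      using assms(2) dvd_add_left_iff[of p "p * j" a] by (auto dest: dvd_imp_le)
    from redcoef_hdiff_pid[OF Omega_exp_le_div Omega_exp_pid this] show ?thesis
      unfolding div .
  qed simp
  have eq: "of_nat p * hdiff N ?m - hdiff N j = of_nat p * (hdiff N ?m - hdiff N (p * j) + hdefect N j)"
    by (simp add: hdefect_def algebra_simps)
  have "r * (q * (x + y)) = q * (r * x + r * y)" for r q x y :: rat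
    by (simp add: algebra_simps)
  then have "redcoef N ?m * (of_nat p * hdiff N ?m - hdiff N j) =
    of_nat p * (redcoef N ?m * (hdiff N ?m - hdiff N (p * j)) + redcoef N ?m * hdefect N j)"
    unfolding eq .
  also have "\<dots> \<in> pid (Omega_exp p N + 1)"
    unfolding p_mult_pid_iff
    using pid_add[OF 1 pid_mult0[OF redcoef_pid[OF m] hdefect_Omega_exp]] by simp
  finally show ?thesis by (rule bcoef_power_mult_pid[OF assms(1) m])
qed

lemma of_nat_powi_pid:
  assumes "\<not> p dvd q"
  shows "of_nat q powi e \<in> pid 0"
proof (cases "e \<ge> 0")
  case True
  then show ?thesis by (simp add: power_int_def pid_power0)
next
  case False
  then have "of_nat q powi e = (1 / of_nat q :: rat) ^ nat (- e)"
    by (simp add: power_int_def inverse_eq_divide)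
  then show ?thesis using pid_power0[OF inverse_of_nat_pid[OF assms]] by simp
qed

text \<open>The factors at primes other than \<open>p\<close> are \<open>p\<close>-integral even for
  negative exponents.\<close>

lemma inverse_Omega_pid: "1 / Omega N \<in> pid (- Omega_exp p N)"
proof -
  let ?Q = "{q. prime q \<and> q \<le> N}"
  define f where "f q = (of_nat q powi - min (2 + omega q N) (rat_val q (harmonic N - 1)) :: rat)" for q
  have fin: "finite ?Q" by (rule finite_subset[of _ "{..N}"]) auto
  have eq: "1 / Omega N = prod f ?Q"
    unfolding Omega_def f_def by (simp add: power_int_minus inverse_eq_divide prod_dividef)
  have rest: "prod f (?Q - {p}) \<in> pid 0"
    unfolding f_def by (intro pid_prod0 of_nat_powi_pid) (use prime_p primes_dvd_imp_eq in auto)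
  show ?thesis
  proof (cases "p \<le> N")
    case True
    then have "prod f ?Q = f p * prod f (?Q - {p})"
      using prime_p by (intro prod.remove fin) auto
    moreover have "f p \<in> pid (- Omega_exp p N)"
      unfolding f_def using True by (simp add: Omega_exp_def p_powi_pid)
    ultimately show ?thesis unfolding eq using pid_mult0'[OF _ rest] by simp
  next
    case False
    then have "?Q - {p} = ?Q" by auto
    then show ?thesis unfolding eq using rest False by (simp add: Omega_exp_def)
  qed
qed

text \<open>Only exponents \<open>p (K - j)\<close> contribute from the first factor, and their
  complements are \<open>a + p j\<close>.\<close>

lemma fps_nth_frobenius_mult:
  assumes "a < p"
  shows "((f oo fps_X ^ p) * g) $ (a + p * K) = (\<Sum>j\<le>K. f $ (K - j) * g $ (a + p * j) :: rat)"
proof -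
  let ?n = "a + p * K" and ?i = "\<lambda>j. p * (K - j)"
  let ?t = "\<lambda>i. (f oo fps_X ^ p) $ i * g $ (?n - i)"
  have inj: "inj_on ?i {..K}" by (auto simp: inj_on_def)
  have zero: "?t i = 0" if "i \<in> {0..?n} - ?i ` {..K}" for i
  proof -
    have "\<not> p dvd i"
    proof
      assume "p dvd i"
      then obtain q where q: "i = p * q" by auto
      have "i div p \<le> ?n div p" using that by (intro div_le_mono) simp
      then have "q \<le> K" using q assms by simp
      then have "i = ?i (K - q)" "K - q \<in> {..K}" using q by auto
      then show False using that by blast
    qed
    then show ?thesis by (simp add: fps_nth_compose_X_power)
  qed
  have "((f oo fps_X ^ p) * g) $ ?n = sum ?t {0..?n}"
    by (simp add: fps_mult_nth)
  also have "\<dots> = sum ?t (?i ` {..K})"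
    using zero by (intro sum.mono_neutral_right) (auto intro!: trans_le_add2 mult_le_mono2)
  also have "\<dots> = (\<Sum>j\<le>K. ?t (?i j))"
    by (simp add: sum.reindex[OF inj])
  also have "\<dots> = (\<Sum>j\<le>K. f $ (K - j) * g $ (a + p * j))"
  proof (rule sum.cong[OF refl])
    fix j assume "j \<in> {..K}"
    then have "p * K = p * (K - j) + p * j" by (simp flip: distrib_left)
    then have "?n - ?i j = a + p * j" by simp
    then show "?t (?i j) = f $ (K - j) * g $ (a + p * j)"
      by (simp add: fps_nth_compose_X_power)
  qed
  finally show ?thesis .
qed

lemma mirror_map_integral:
  fixes N k :: nat
  assumes k: "k > 0"
  defines "F \<equiv> Abs_fps (\<lambda>m. bcoef N m ^ k)"
    and "G \<equiv> Abs_fps (\<lambda>m. bcoef N m ^ k * hdiff N m)"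
  shows "fps_exp_of (fps_const (1 / (Omega N * fact N ^ k)) * (G / F)) \<in> pfps 0"
proof (rule dwork_exp_integral)
  interpret dwork_sequence p "\<lambda>m. bcoef N m ^ k" by (rule bcoef_power_dwork)
  let ?c = "1 / (Omega N * fact N ^ k)" and ?w = "Omega_exp p N"
  let ?h = "fps_const ?c * (G / F)"
  let ?frob = "\<lambda>f :: rat fps. f oo fps_X ^ p"
  have X0: "(fps_X ^ p :: rat fps) $ 0 = 0" by (simp add: fps_X_power_nth)
  have F0: "F $ 0 = 1" and G0: "G $ 0 = 0" by (simp_all add: F_def G_def)
  have Fp: "F \<in> pfps 0" unfolding F_def pfps_def by (auto intro: pid_power0)
  have GF: "G / F = G * inverse F" using F0 by (simp add: fps_divide_unit)
  show "?h $ 0 = 0" using G0 by (simp add: GF)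
  have frob_h: "?frob ?h = fps_const ?c * (?frob G * inverse (?frob F))"
    unfolding GF using X0 F0 by (simp add: fps_compose_mult_distrib fps_inverse_compose)
  have invF: "inverse F * F = 1" "inverse (?frob F) * ?frob F = 1"
    using F0 by (simp_all add: inverse_mult_eq_1)
  \<comment> \<open>Clearing the denominators \<open>F(z)\<close> and \<open>F(z^p)\<close> leaves
    \<open>L\<close>, whose coefficients are minus the sums in
    \<open>dwork_convolution\<close>.\<close>
  define L where "L = fps_const (of_nat p) * (?frob F * G) - ?frob G * F"
  define c' where "c' = ?c / of_nat p"
  have "?h - fps_const (1 / of_nat p) * ?frob ?h =
     fps_const c' * L * (inverse F * inverse (?frob F))"
  proof -
    have "fps_const c' * fps_const (of_nat p) = fps_const ?c"
      "fps_const (1 / of_nat p) * fps_const ?c = fps_const c'"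
      by (simp_all add: c'_def)
    then have "?h - fps_const (1 / of_nat p) * ?frob ?h =
      fps_const c' * fps_const (of_nat p) * (G * inverse F) - fps_const c' * (?frob G * inverse (?frob F))"
      unfolding frob_h unfolding GF by (simp only: mult.assoc[symmetric])
    also have "\<dots> = fps_const c' * fps_const (of_nat p) * (G * inverse F) * (inverse (?frob F) * ?frob F)
       - fps_const c' * (?frob G * inverse (?frob F)) * (inverse F * F)"
      by (simp only: invF mult_1_right)
    also have "\<dots> = fps_const c' * L * (inverse F * inverse (?frob F))"
      unfolding L_def by (simp only: right_diff_distrib left_diff_distrib mult_ac)
    finally show ?thesis .
  qed
  also have "\<dots> \<in> pfps 0"
  proof (rule pfps_mult0[OF _ pfps_mult0])
    show "inverse F \<in> pfps 0" using Fp F0 by (rule pfps_inverse)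
    show "inverse (?frob F) \<in> pfps 0"
      using pfps_frobenius[OF Fp] F0 by (intro pfps_inverse) auto
    show "fps_const c' * L \<in> pfps 0"
      unfolding pfps_def
    proof safe
      fix n
      define a K where "a = n mod p" and "K = n div p"
      have a: "a < p" and n: "n = a + p * K" by (simp_all add: a_def K_def)
      let ?A = "\<lambda>m. bcoef N m ^ k" and ?D = "hdiff N"
      let ?S = "\<Sum>j\<le>K. ?A (a + p * j) * ?A (K - j) * (?D (K - j) - of_nat p * ?D (a + p * j))"
      have "L $ n = - ?S"
        unfolding L_def n fps_sub_nth fps_mult_left_const_nth fps_nth_frobenius_mult[OF a]
        by (simp add: F_def G_def sum_distrib_left algebra_simps flip: sum_subtractf sum_negf)
      then have "(fps_const c' * L) $ n = (1 / Omega N) * (inverse (of_nat p) * - (?S / fact N ^ k))"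
        by (simp add: c'_def field_simps)
      \<comment> \<open>The exponents balance: \<open>- ?w\<close> from \<open>1 / Omega N\<close>,
        \<open>- 1\<close> from \<open>1 / p\<close>, and \<open>?w + 1\<close> from Dwork's
        congruences.\<close>
      also have "\<dots> \<in> pid (- ?w + (- 1 + (?w + 1)))"
        by (intro pid_mult inverse_Omega_pid p_inverse_pid pid_uminus dwork_convolution a
            hdiff_levels_pid hdiff_residue_pid k hdiff_0)
      finally show "(fps_const c' * L) $ n \<in> pid 0" by simp
    qed
  qed
  finally show "?h - fps_const (1 / of_nat p) * ?frob ?h \<in> pfps 0" .
qed

end

theorem theorem4:
  fixes N k :: nat
  assumes "N \<ge> 2" and "k \<ge> 1"
  shows "\<forall>n. fps_nth (fps_rat_power (q_ser N k / fps_X)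
                (1 / (Omega N * fact N ^ k * of_nat k * of_nat N))) n \<in> \<int>"
proof
  fix n
  define F where "F = Abs_fps (\<lambda>m. bcoef N m ^ k)"
  define G where "G = Abs_fps (\<lambda>m. bcoef N m ^ k * hdiff N m)"
  let ?c = "1 / (Omega N * fact N ^ k * of_nat k * of_nat N)"
  have F0: "F $ 0 = 1" and G0: "G $ 0 = 0" by (simp_all add: F_def G_def)
  have h: "G_ser N k / F_ser N k = fps_const (of_nat k * of_nat N) * (G / F)"
    using assms F0 by (simp add: G_ser_bcoef F_ser_bcoef F_def G_def fps_divide_unit mult.assoc)
  have h0: "(G_ser N k / F_ser N k) $ 0 = 0"
    unfolding h using F0 G0 by (simp add: fps_divide_unit)
  \<comment> \<open>The factor \<open>k N\<close> in \<open>G_ser\<close> cancels the one in the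
    root.\<close>
  have "?c * (of_nat k * of_nat N) = 1 / (Omega N * fact N ^ k)"
    using assms by simp
  then have c: "fps_const ?c * (G_ser N k / F_ser N k) = fps_const (1 / (Omega N * fact N ^ k)) * (G / F)"
    unfolding h by (simp only: mult.assoc[symmetric] fps_const_mult)
  have "q_ser N k / fps_X = fps_exp_of (G_ser N k / F_ser N k)"
    unfolding q_ser_def by (rule nonzero_mult_div_cancel_left) simp
  then have power: "fps_rat_power (q_ser N k / fps_X) ?c =
      fps_exp_of (fps_const (1 / (Omega N * fact N ^ k)) * (G / F))"
    unfolding fps_rat_power_def by (simp only: fps_ln_fps_exp_of[OF h0] c)
  show "fps_rat_power (q_ser N k / fps_X) ?c $ n \<in> \<int>"
  proof (rule Ints_if_all_p_adic)
    fix p :: nat assume p: "prime p"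
    interpret p_adic p by standard (rule p)
    show "fps_rat_power (q_ser N k / fps_X) ?c $ n \<in> pid 0"
      unfolding power F_def G_def using assms by (intro pfpsD mirror_map_integral) simp
  qed
qed

end
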